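(* Suppose that the boundary conditions (I)–(II) are co-normal with respect to $l$, and let $F$ be the associated sesquilinear form on $\mathcal{D}(F)$. Let $\lambda\in\mathbb{C}$ and let $u$ be a function on $G$. Then $u\in\mathcal{D}(F)$ and $F(u,v)=\lambda (Bu,v)$ for all $v\in\mathcal{D}(F)$ if and only if $u\in\mathcal{H}^2(G)$, $u$ satisfies $-u''+qu=\lambda Bu$ on $G$, and $u$ satisfies the boundary conditions (I) and (II).
   Context: Graph and spaces. $G$ is an oriented graph with finitely many edges $e_1,\dots,e_K$, each of length $1$; $e_i$ is identified with $[0,1]$, with $0$ the initial and $1$ the terminal point. A complex-valued function $y$ on $G$ is a tuple $(y_1,\dots,y_K)$ with $y_i=y|_{e_i}$ a function on $[0,1]$. Put $\mathcal{L}^2(G)=\bigoplus_{i=1}^K L^2(0,1)$ and $\mathcal{H}^m(G)=\bigoplus_{i=1}^K H^m(0,1)$ (Sobolev spaces), $\int_G h\,dt=\sum_i\int_0^1 h_i\,dt$, $(f,g)=\int_G f\bar g\,dt$, $\|f\|^2=(f,f)$. Equation. $q$ is real-valued and essentially bounded on $G$; $b=1$ on the edges $e_1,\dots,e_p$ and $b=-1$ on $e_{p+1},\dots,e_K$; $(By)(x)=b(x)y(x)$. The differential expression is $ly=-y''+qy$ and the equation is $-y''+qy=\lambda By$ on $G$ (i.e. $-y_i''+q_iy_i=\lambda b_iy_i$ on each edge). Boundary conditions. At the nodes of $G$ one imposes in total $2K$ linearly independent linear homogeneous conditions with constant coefficients, each involving only the values of $y$ and $y'$ at the edge ends incident to one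 node, which are formally self-adjoint, i.e. $(lx,y)=(x,ly)$ for all $x,y\in\mathcal{H}^2(G)$ satisfying the conditions. They are written as (I) $\sum_{j=1}^K[\alpha_{ij}y_j(0)+\gamma_{ij}y_j(1)]=0$, $i=1,\dots,J$; (II) $\sum_{j=1}^K[\alpha_{ij}y_j(0)+\beta_{ij}y_j'(0)+\gamma_{ij}y_j(1)+\delta_{ij}y_j'(1)]=0$, $i=J+1,\dots,2K$, where all Dirichlet-like conditions are in (I), that is, every linear combination of (I)–(II) containing no derivative terms is a linear combination of the conditions (I) alone. Co-normal conditions and the form $F$. $\mathcal{D}(F)=\{y\in\mathcal{H}^1(G): y \text{ satisfies (I)}\}$. For a function $y$ on the set $\partial G$ of the $2K$ edge ends, $\int_{\partial G}y\,d\sigma=\sum_{i=1}^K[y_i(1)-y_i(0)]$. The boundary conditions are called co-normal (or elliptic) with respect to $l$ if there is a function $f$ on $\partial G$ (one scalar for each of the $2K$ edge ends) such that, for $x\in\mathcal{D}(F)\cap\mathcal{H}^2(G)$, one has $\int_{\partial G}(fx+x')\bar y\,d\sigma=0$ for all $y\in\mathcal{D}(F)$ if and only if $x$ satisfies (II). For co-normal conditions with such an $f$ fixed, $F(x,y)=\int_{\partial G}fx\bar y\,d\sigma+\int_G(x'\bar y'+qx\bar y)\,dt$ for $x,y\in\mathcal{D}(F)$. *)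

theory Defs
  imports "HOL-Analysis.Analysis" "Graph_Theory.Digraph"
begin

section \<open>Sobolev spaces on the unit interval\<close>

text \<open>
  Elements of \<open>L\<^sup>2(0,1)\<close> and \<open>H\<^sup>m(0,1)\<close> are represented by functions on the reals of which
  only the restriction to \<open>[0,1]\<close> matters, and this only up to equality almost everywhere.
  Every notion below is invariant under such changes.
\<close>

abbreviation unit_lebesgue :: "real measure" where
  "unit_lebesgue \<equiv> lebesgue_on {0..1}"

definition L2 :: "(real \<Rightarrow> complex) set" where
  "L2 = {y \<in> borel_measurable unit_lebesgue. integrable unit_lebesgue (\<lambda>t. (cmod (y t))\<^sup>2)}"

definition essentially_bounded :: "(real \<Rightarrow> real) \<Rightarrow> bool" where
  "essentially_bounded h \<longleftrightarrow>
     h \<in> borel_measurable unit_lebesgue \<and> (\<exists>C. AE t in unit_lebesgue. \<bar>h t\<bar> \<le> C)"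

text \<open>The space \<open>C\<^sub>c\<^sup>1(0,1)\<close>, extended by zero to the real line.\<close>

definition test_function :: "(real \<Rightarrow> complex) \<Rightarrow> bool" where
  "test_function \<phi> \<longleftrightarrow> \<phi> C1_differentiable_on UNIV \<and>
     (\<exists>a b. 0 < a \<and> b < 1 \<and> (\<forall>t. t \<notin> {a..b} \<longrightarrow> \<phi> t = 0))"

text \<open>
  Weak derivatives on an interval are taken with respect to test functions in \<open>C\<^sub>c\<^sup>1\<close>, and
  \<open>H\<^sup>m\<close> is obtained from \<open>H\<^sup>0 = L\<^sup>2\<close> by requiring a weak derivative in \<open>H\<^sup>m\<^sup>-\<^sup>1\<close>, as in Brezis,
  Functional Analysis, Sobolev Spaces and Partial Differential Equations, Section 8.2.
\<close>

definition has_weak_deriv :: "(real \<Rightarrow> complex) \<Rightarrow> (real \<Rightarrow> complex) \<Rightarrow> bool" where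
  "has_weak_deriv y g \<longleftrightarrow> (\<forall>\<phi>. test_function \<phi> \<longrightarrow>
     (LINT t|unit_lebesgue. y t * vector_derivative \<phi> (at t)) =
     - (LINT t|unit_lebesgue. g t * \<phi> t))"

primrec sobolev :: "nat \<Rightarrow> (real \<Rightarrow> complex) set" where
  "sobolev 0 = L2"
| "sobolev (Suc m) = {y \<in> L2. \<exists>g \<in> sobolev m. has_weak_deriv y g}"

text \<open>\<open>y'\<close>, determined almost everywhere if \<open>y\<close> is in \<open>H\<^sup>1\<close>.\<close>

definition wderiv :: "(real \<Rightarrow> complex) \<Rightarrow> (real \<Rightarrow> complex)" where
  "wderiv y = (SOME g. g \<in> L2 \<and> has_weak_deriv y g)"

text \<open>
  The value at \<open>t\<close> of the continuous representative on \<open>[0,1]\<close>.  It exists for \<open>y\<close> in \<open>H\<^sup>1\<close>, and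
  its values on \<open>[0,1]\<close> are then unique; all end values \<open>y(0)\<close>, \<open>y(1)\<close>, \<open>y'(0)\<close>, \<open>y'(1)\<close>
  are understood in this sense.
\<close>

definition pt_value :: "(real \<Rightarrow> complex) \<Rightarrow> real \<Rightarrow> complex" where
  "pt_value y = (SOME g. continuous_on {0..1} g \<and> (AE t in unit_lebesgue. g t = y t))"

section \<open>Functions on the graph\<close>

text \<open>
  The edges are numbered by \<open>{1..K}\<close>, and a function on the graph is the family of its
  restrictions to the edges; components with index outside \<open>{1..K}\<close> are irrelevant.
\<close>

type_synonym graph_fun = "nat \<Rightarrow> real \<Rightarrow> complex"

definition graph_sobolev :: "nat \<Rightarrow> nat \<Rightarrow> graph_fun set" where
  "graph_sobolev K m = {y. \<forall>i\<in>{1..K}. y i \<in> sobolev m}"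

definition graph_integral :: "nat \<Rightarrow> graph_fun \<Rightarrow> complex" where
  "graph_integral K h = (\<Sum>i=1..K. LINT t|unit_lebesgue. h i t)"

definition graph_inner :: "nat \<Rightarrow> graph_fun \<Rightarrow> graph_fun \<Rightarrow> complex" where
  "graph_inner K x y = graph_integral K (\<lambda>i t. x i t * cnj (y i t))"

text \<open>
  A function on the set of the \<open>2K\<close> edge ends is given by its values at \<open>(i, 0)\<close> and \<open>(i, 1)\<close>
  for \<open>i\<close> in \<open>{1..K}\<close>, so the type \<^typ>\<open>graph_fun\<close> serves here too.
\<close>

definition boundary_integral :: "nat \<Rightarrow> graph_fun \<Rightarrow> complex" where
  "boundary_integral K h = (\<Sum>i=1..K. h i 1 - h i 0)"

definition gderiv :: "graph_fun \<Rightarrow> graph_fun" where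
  "gderiv y = (\<lambda>i. wderiv (y i))"

definition gval :: "graph_fun \<Rightarrow> graph_fun" where
  "gval y = (\<lambda>i. pt_value (y i))"

definition weight :: "nat \<Rightarrow> nat \<Rightarrow> complex" where
  "weight p i = (if i \<le> p then 1 else -1)"

definition B_op :: "nat \<Rightarrow> graph_fun \<Rightarrow> graph_fun" where
  "B_op p y = (\<lambda>i t. weight p i * y i t)"

definition l_op :: "(nat \<Rightarrow> real \<Rightarrow> real) \<Rightarrow> graph_fun \<Rightarrow> graph_fun" where
  "l_op q y = (\<lambda>i t. - gderiv (gderiv y) i t + complex_of_real (q i t) * y i t)"

section \<open>Boundary conditions\<close>

text \<open>
  The first \<open>bc_J\<close> conditions form (I), the others, up to index \<open>2K\<close>, form (II).
  The arguments of the coefficients are the number of the condition and the edge.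
\<close>

record bdry_conds =
  bc_J :: nat
  bc_alpha :: "nat \<Rightarrow> nat \<Rightarrow> complex"
  bc_beta :: "nat \<Rightarrow> nat \<Rightarrow> complex"
  bc_gamma :: "nat \<Rightarrow> nat \<Rightarrow> complex"
  bc_delta :: "nat \<Rightarrow> nat \<Rightarrow> complex"

definition satisfies_I :: "nat \<Rightarrow> bdry_conds \<Rightarrow> graph_fun \<Rightarrow> bool" where
  "satisfies_I K bc y \<longleftrightarrow> (\<forall>i\<in>{1..bc_J bc}.
     (\<Sum>j=1..K. bc_alpha bc i j * gval y j 0 + bc_gamma bc i j * gval y j 1) = 0)"

definition satisfies_II :: "nat \<Rightarrow> bdry_conds \<Rightarrow> graph_fun \<Rightarrow> bool" where
  "satisfies_II K bc y \<longleftrightarrow> (\<forall>i\<in>{bc_J bc + 1..2 * K}.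
     (\<Sum>j=1..K. bc_alpha bc i j * gval y j 0 + bc_beta bc i j * gval (gderiv y) j 0
             + bc_gamma bc i j * gval y j 1 + bc_delta bc i j * gval (gderiv y) j 1) = 0)"

text \<open>
  Conditions (I) carry no coefficients of derivatives; they are padded with zeros so that
  linear combinations of (I) and (II) can be written uniformly.
\<close>

definition padded :: "nat \<Rightarrow> bdry_conds \<Rightarrow> bool" where
  "padded K bc \<longleftrightarrow> bc_J bc \<le> 2 * K \<and>
     (\<forall>i\<in>{1..bc_J bc}. \<forall>j\<in>{1..K}. bc_beta bc i j = 0 \<and> bc_delta bc i j = 0)"

definition local_conds :: "('v, nat) pre_digraph \<Rightarrow> nat \<Rightarrow> bdry_conds \<Rightarrow> bool" where
  "local_conds G K bc \<longleftrightarrow> (\<forall>i\<in>{1..2 * K}. \<exists>v\<in>verts G. \<forall>j\<in>{1..K}.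
     (tail G j \<noteq> v \<longrightarrow> bc_alpha bc i j = 0 \<and> bc_beta bc i j = 0) \<and>
     (head G j \<noteq> v \<longrightarrow> bc_gamma bc i j = 0 \<and> bc_delta bc i j = 0))"

definition independent_conds :: "nat \<Rightarrow> bdry_conds \<Rightarrow> bool" where
  "independent_conds K bc \<longleftrightarrow> (\<forall>c :: nat \<Rightarrow> complex.
     (\<forall>j\<in>{1..K}. (\<Sum>i=1..2 * K. c i * bc_alpha bc i j) = 0 \<and>
                  (\<Sum>i=1..2 * K. c i * bc_beta bc i j) = 0 \<and>
                  (\<Sum>i=1..2 * K. c i * bc_gamma bc i j) = 0 \<and>
                  (\<Sum>i=1..2 * K. c i * bc_delta bc i j) = 0)
     \<longrightarrow> (\<forall>i\<in>{1..2 * K}. c i = 0))"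

definition dirichlet_like_in_I :: "nat \<Rightarrow> bdry_conds \<Rightarrow> bool" where
  "dirichlet_like_in_I K bc \<longleftrightarrow> (\<forall>c :: nat \<Rightarrow> complex.
     (\<forall>j\<in>{1..K}. (\<Sum>i=1..2 * K. c i * bc_beta bc i j) = 0 \<and>
                  (\<Sum>i=1..2 * K. c i * bc_delta bc i j) = 0)
     \<longrightarrow> (\<exists>d :: nat \<Rightarrow> complex. \<forall>j\<in>{1..K}.
            (\<Sum>i=1..2 * K. c i * bc_alpha bc i j) = (\<Sum>i=1..bc_J bc. d i * bc_alpha bc i j) \<and>
            (\<Sum>i=1..2 * K. c i * bc_gamma bc i j) = (\<Sum>i=1..bc_J bc. d i * bc_gamma bc i j)))"

definition formally_self_adjoint ::
  "nat \<Rightarrow> (nat \<Rightarrow> real \<Rightarrow> real) \<Rightarrow> bdry_conds \<Rightarrow> bool" where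
  "formally_self_adjoint K q bc \<longleftrightarrow> (\<forall>x\<in>graph_sobolev K 2. \<forall>y\<in>graph_sobolev K 2.
     satisfies_I K bc x \<and> satisfies_II K bc x \<and> satisfies_I K bc y \<and> satisfies_II K bc y
     \<longrightarrow> graph_inner K (l_op q x) y = graph_inner K x (l_op q y))"

section \<open>Co-normal conditions and the sesquilinear form\<close>

definition form_domain :: "nat \<Rightarrow> bdry_conds \<Rightarrow> graph_fun set" where
  "form_domain K bc = {y \<in> graph_sobolev K 1. satisfies_I K bc y}"

text \<open>The conditions are co-normal if \<open>co_normal_via K bc f\<close> holds for some \<open>f\<close>.\<close>

definition co_normal_via :: "nat \<Rightarrow> bdry_conds \<Rightarrow> graph_fun \<Rightarrow> bool" where
  "co_normal_via K bc f \<longleftrightarrow> (\<forall>x \<in> form_domain K bc \<inter> graph_sobolev K 2.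
     (\<forall>y \<in> form_domain K bc. boundary_integral K
        (\<lambda>i t. (f i t * gval x i t + gval (gderiv x) i t) * cnj (gval y i t)) = 0)
     \<longleftrightarrow> satisfies_II K bc x)"

definition form ::
  "nat \<Rightarrow> (nat \<Rightarrow> real \<Rightarrow> real) \<Rightarrow> graph_fun \<Rightarrow> graph_fun \<Rightarrow> graph_fun \<Rightarrow> complex" where
  "form K q f x y =
     boundary_integral K (\<lambda>i t. f i t * gval x i t * cnj (gval y i t)) +
     graph_integral K (\<lambda>i t. gderiv x i t * cnj (gderiv y i t)
                           + complex_of_real (q i t) * x i t * cnj (y i t))"

end

theory Submission
  imports Defs
begin

text \<open>
  Weak solutions are strong solutions by testing twice, first in the interior of the edges and then
  at the nodes.

  The analytic input is one-dimensional Sobolev theory.  Integration by parts holds for indefinite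
  integrals of integrable functions by Fubini's theorem (\<open>integration_by_parts_primitive\<close>).  By the
  lemma of du Bois-Reymond (\<open>du_Bois_Reymond\<close>) weak derivatives are unique almost everywhere, and a
  function in \<open>H\<^sup>1\<close> is almost everywhere an indefinite integral of its weak derivative
  (\<open>weak_deriv_imp_primitive\<close>).  So its end values are those of an absolutely continuous function,
  and integration by parts carries over to \<open>H\<^sup>1\<close> (\<open>sobolev_integration_by_parts\<close>).  Applied to \<open>u'\<close>
  and \<open>v\<close> on every edge it gives, for \<open>u\<close> in \<open>H\<^sup>2\<close>,
  \<open>F(u,v) - \<lambda>(Bu,v) = \<integral> (f u + u') \<sigma> + (l u - \<lambda>Bu, v)\<close>, where the integral, with
  \<open>\<sigma>\<close> the conjugate of \<open>v\<close>, is over the edge ends (\<open>form_minus_inner\<close>).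

  If \<open>u\<close> solves the boundary value problem, then the second term on the right vanishes by the
  equation and the first one by co-normality, so \<open>u\<close> is a weak solution.  Conversely, a weak solution
  tested with functions of compact support in one open edge shows that \<open>u''\<close> exists weakly and is
  \<open>q u - \<lambda>Bu\<close>, which is square integrable as \<open>q\<close> is bounded; hence \<open>u\<close> is in \<open>H\<^sup>2\<close> and satisfies the
  equation (\<open>weak_solution_regular\<close>).  Now the formula leaves only the boundary term, which vanishes
  for all \<open>v\<close> in the form domain, and by co-normality this is (II).
\<close>

section \<open>Primitives of integrable functions\<close>

lemma finite_measure_unit_lebesgue: "finite_measure unit_lebesgue"
  by (rule finite_measure_lebesgue_on) simp

interpretation unit: finite_measure unit_lebesgue
  by (rule finite_measure_unit_lebesgue)

interpretation unit2: pair_sigma_finite unit_lebesgue unit_lebesgue ..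

lemma continuous_measurable_unit:
  fixes Y :: "real \<Rightarrow> complex"
  assumes "continuous_on {0..1} Y"
  shows "Y \<in> borel_measurable unit_lebesgue"
  using assms by (intro continuous_imp_measurable_on_sets_lebesgue) auto

lemma integrable_continuous_times:
  fixes Y g :: "real \<Rightarrow> complex"
  assumes "continuous_on {0..1} Y" and g: "integrable unit_lebesgue g"
  shows "integrable unit_lebesgue (\<lambda>t. Y t * g t)"
proof -
  have Ym: "Y \<in> borel_measurable unit_lebesgue"
    using assms(1) by (rule continuous_measurable_unit)
  have "compact (Y ` {0..1})"
    using assms(1) by (intro compact_continuous_image) auto
  then obtain C where C: "\<And>t. t \<in> {0..1} \<Longrightarrow> cmod (Y t) \<le> C"
    using compact_imp_bounded bounded_iff by (metis imageI)
  show ?thesis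
  proof (rule Bochner_Integration.integrable_bound)
    show "integrable unit_lebesgue (\<lambda>t. C * cmod (g t))" using g by simp
    show "(\<lambda>t. Y t * g t) \<in> borel_measurable unit_lebesgue"
      using Ym g by measurable
    show "AE t in unit_lebesgue. norm (Y t * g t) \<le> norm (C * cmod (g t))"
    proof (rule AE_I2)
      fix t :: real assume "t \<in> space unit_lebesgue"
      then have "cmod (Y t) \<le> C" using C by simp
      moreover from this have "0 \<le> C" using norm_ge_zero order_trans by blast
      ultimately show "norm (Y t * g t) \<le> norm (C * cmod (g t))"
        by (simp add: norm_mult mult_right_mono)
    qed
  qed
qed

text \<open>
  \<open>Y\<close> is absolutely continuous on \<open>[0,1]\<close> with derivative \<open>g\<close>, expressed as an indefinite integral.
  Values of \<open>Y\<close> outside \<open>[0,1]\<close> are irrelevant.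
\<close>

definition primitive_of :: "(real \<Rightarrow> complex) \<Rightarrow> (real \<Rightarrow> complex) \<Rightarrow> bool" where
  "primitive_of Y g \<longleftrightarrow> integrable unit_lebesgue g \<and> (\<forall>t\<in>{0..1}. Y t = Y 0 + integral {0..t} g)"

text \<open>
  Indefinite integrals as Lebesgue integrals over the whole unit interval, the form that Fubini's
  theorem needs.  The end point of integration may be left out, because it is a null set.
\<close>

lemma integral_eq_restricted_lebesgue:
  fixes g :: "real \<Rightarrow> complex"
  assumes g: "integrable unit_lebesgue g" and t: "t \<in> {0..1}"
  shows "integral {0..t} g = (LINT s|unit_lebesgue. (if s \<le> t then g s else 0))"
    and "integral {0..t} g = (LINT s|unit_lebesgue. (if s < t then g s else 0))"
proof -
  have m: "(\<lambda>s. s) \<in> borel_measurable unit_lebesgue"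
    by (intro continuous_imp_measurable_on_sets_lebesgue) auto
  have gm: "g \<in> borel_measurable unit_lebesgue" using g by simp
  have i1: "integrable unit_lebesgue (\<lambda>s. (if s \<le> t then g s else 0))"
    by (rule Bochner_Integration.integrable_bound[OF g]) (use m gm in auto)
  have i2: "integrable unit_lebesgue (\<lambda>s. (if s < t then g s else 0))"
    by (rule Bochner_Integration.integrable_bound[OF g]) (use m gm in auto)
  have "(LINT s|unit_lebesgue. (if s \<le> t then g s else 0)) = integral {0..1} (\<lambda>s. (if s \<in> {..t} then g s else 0))"
    using lebesgue_integral_eq_integral[OF i1] by simp
  also have "\<dots> = integral ({0..1} \<inter> {..t}) g"
    by (metis Int_commute Henstock_Kurzweil_Integration.integral_restrict_Int)
  also have "{0..1} \<inter> {..t} = {0..t}" using t by auto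
  finally show 1: "integral {0..t} g = (LINT s|unit_lebesgue. (if s \<le> t then g s else 0))" ..
  have "(LINT s|unit_lebesgue. (if s < t then g s else 0)) = integral {0..1} (\<lambda>s. (if s < t then g s else 0))"
    using lebesgue_integral_eq_integral[OF i2] by simp
  also have "\<dots> = integral {0..1} (\<lambda>s. (if s \<le> t then g s else 0))"
    by (rule integral_spike[of "{t}"]) auto
  also have "\<dots> = (LINT s|unit_lebesgue. (if s \<le> t then g s else 0))"
    using lebesgue_integral_eq_integral[OF i1] by simp
  finally show "integral {0..t} g = (LINT s|unit_lebesgue. (if s < t then g s else 0))"
    using 1 by simp
qed

lemma integrable_unit_integral:
  fixes g :: "real \<Rightarrow> complex"
  assumes g: "integrable unit_lebesgue g"
  shows "integral {0..1} g = (LINT s|unit_lebesgue. g s)"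
  using lebesgue_integral_eq_integral[OF g] by simp

lemma continuous_indefinite_integral:
  fixes g :: "real \<Rightarrow> complex"
  assumes g: "integrable unit_lebesgue g"
  shows "continuous_on {0..1} (\<lambda>t. integral {0..t} g)"
  using integrable_on_lebesgue_on[OF g] by (intro indefinite_integral_continuous_1) simp

text \<open>
  The unit square splits into the triangles \<open>s < t\<close> and \<open>t \<le> s\<close>; integrating \<open>g s * h t\<close> over
  each of them by Fubini's theorem gives the two summands on the left.
\<close>

lemma fubini_triangle:
  fixes g h :: "real \<Rightarrow> complex"
  assumes g: "integrable unit_lebesgue g" and h: "integrable unit_lebesgue h"
  shows "(LINT t|unit_lebesgue. integral {0..t} g * h t + g t * integral {0..t} h)
       = integral {0..1} g * integral {0..1} h"
proof -
  define k where "k s t = (if s < t then g s * h t else 0)" for s t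
  define k' where "k' s t = (if t \<le> s then g s * h t else 0)" for s t
  have m[measurable]: "(\<lambda>s::real. s) \<in> borel_measurable unit_lebesgue"
    by (intro continuous_imp_measurable_on_sets_lebesgue) auto
  have [measurable]: "g \<in> borel_measurable unit_lebesgue" "h \<in> borel_measurable unit_lebesgue"
    using g h by simp_all
  have fs[measurable]: "(\<lambda>p. fst p) \<in> borel_measurable (unit_lebesgue \<Otimes>\<^sub>M unit_lebesgue)"
     "(\<lambda>p. snd p) \<in> borel_measurable (unit_lebesgue \<Otimes>\<^sub>M unit_lebesgue)"
    using measurable_compose[OF measurable_fst m] measurable_compose[OF measurable_snd m] by simp_all
  have gh: "integrable (unit_lebesgue \<Otimes>\<^sub>M unit_lebesgue) (\<lambda>(s, t). g s * h t)"
    by (rule unit2.Fubini_integrable) (use g h in \<open>auto simp: norm_mult\<close>)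
  have kk: "integrable (unit_lebesgue \<Otimes>\<^sub>M unit_lebesgue) (case_prod k)"
    unfolding k_def split_beta
    by (rule Bochner_Integration.integrable_bound[OF gh]) auto
  have kk': "integrable (unit_lebesgue \<Otimes>\<^sub>M unit_lebesgue) (case_prod k')"
    unfolding k'_def split_beta
    by (rule Bochner_Integration.integrable_bound[OF gh]) auto
  have 1: "(LINT s|unit_lebesgue. k s t) = integral {0..t} g * h t" if "t \<in> {0..1}" for t
  proof -
    have "k s t = (if s < t then g s else 0) * h t" for s by (simp add: k_def)
    then show ?thesis
      by (simp add: integral_eq_restricted_lebesgue(2)[OF g that])
  qed
  have 2: "(LINT t|unit_lebesgue. k' s t) = g s * integral {0..s} h" if "s \<in> {0..1}" for s
  proof -
    have "k' s t = g s * (if t \<le> s then h t else 0)" for t by (simp add: k'_def)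
    then show ?thesis
      by (simp add: integral_eq_restricted_lebesgue(1)[OF h that])
  qed
  have i1: "integrable unit_lebesgue (\<lambda>t. integral {0..t} g * h t)"
    by (intro integrable_continuous_times continuous_indefinite_integral g h)
  have i2: "integrable unit_lebesgue (\<lambda>t. g t * integral {0..t} h)"
    using integrable_continuous_times[OF continuous_indefinite_integral[OF h] g]
    by (simp add: mult.commute)
  have "(LINT t|unit_lebesgue. integral {0..t} g * h t)
      = (LINT t|unit_lebesgue. (LINT s|unit_lebesgue. k s t))"
    by (rule Bochner_Integration.integral_cong) (simp_all add: 1)
  moreover have "(LINT t|unit_lebesgue. g t * integral {0..t} h)
      = (LINT s|unit_lebesgue. (LINT t|unit_lebesgue. k' s t))"
    by (rule Bochner_Integration.integral_cong) (simp_all add: 2)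
  ultimately have "(LINT t|unit_lebesgue. integral {0..t} g * h t + g t * integral {0..t} h)
     = (LINT p|(unit_lebesgue \<Otimes>\<^sub>M unit_lebesgue). case_prod k p) 
     + (LINT p|(unit_lebesgue \<Otimes>\<^sub>M unit_lebesgue). case_prod k' p)"
    using i1 i2 unit2.integral_snd[OF kk] unit2.integral_fst[OF kk'] by simp
  also have "\<dots> = (LINT p|(unit_lebesgue \<Otimes>\<^sub>M unit_lebesgue). case_prod k p + case_prod k' p)"
    using kk kk' by simp
  also have "\<dots> = (LINT p|(unit_lebesgue \<Otimes>\<^sub>M unit_lebesgue). (\<lambda>(s, t). g s * h t) p)"
    by (rule Bochner_Integration.integral_cong) (auto simp: k_def k'_def)
  also have "\<dots> = (LINT s|unit_lebesgue. (LINT t|unit_lebesgue. g s * h t))"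
    using unit2.integral_fst[OF gh] by simp
  also have "\<dots> = integral {0..1} g * integral {0..1} h"
    by (simp add: integrable_unit_integral g h)
  finally show ?thesis .
qed

lemma primitive_of_continuous:
  assumes "primitive_of Y g"
  shows "continuous_on {0..1} Y"
proof -
  have "continuous_on {0..1} (\<lambda>t. Y 0 + integral {0..t} g)"
    using assms by (intro continuous_intros continuous_indefinite_integral) (simp add: primitive_of_def)
  then show ?thesis
    by (rule continuous_on_eq) (metis assms primitive_of_def)
qed

text \<open>
  Integration by parts for absolutely continuous functions.  Neither derivative has to exist
  everywhere, so this is not an instance of the fundamental theorem of calculus for the product.
\<close>

lemma integration_by_parts_primitive:
  assumes Y: "primitive_of Y g" and Z: "primitive_of Z h"
  shows "(LINT t|unit_lebesgue. Y t * h t) + (LINT t|unit_lebesgue. g t * Z t) = Y 1 * Z 1 - Y 0 * Z 0"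
proof -
  define A where "A t = integral {0..t} g" for t
  define C where "C t = integral {0..t} h" for t
  have g: "integrable unit_lebesgue g" and h: "integrable unit_lebesgue h"
    and Yt: "\<And>t. t \<in> {0..1} \<Longrightarrow> Y t = Y 0 + A t"
    and Zt: "\<And>t. t \<in> {0..1} \<Longrightarrow> Z t = Z 0 + C t"
    using Y Z unfolding primitive_of_def A_def C_def by blast+
  have iA: "integrable unit_lebesgue (\<lambda>t. A t * h t)" unfolding A_def
    by (intro integrable_continuous_times continuous_indefinite_integral g h)
  have iC: "integrable unit_lebesgue (\<lambda>t. g t * C t)" unfolding C_def
    using integrable_continuous_times[OF continuous_indefinite_integral[OF h] g]
    by (simp add: mult.commute)
  have "(LINT t|unit_lebesgue. Y t * h t) = (LINT t|unit_lebesgue. Y 0 * h t + A t * h t)"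
    by (intro Bochner_Integration.integral_cong refl) (subst Yt, auto simp: distrib_right)
  also have "\<dots> = Y 0 * C 1 + (LINT t|unit_lebesgue. A t * h t)"
    using h iA by (simp add: C_def integrable_unit_integral)
  finally have 1: "(LINT t|unit_lebesgue. Y t * h t) = \<dots>" .
  have "(LINT t|unit_lebesgue. g t * Z t) = (LINT t|unit_lebesgue. g t * Z 0 + g t * C t)"
    by (intro Bochner_Integration.integral_cong refl) (subst Zt, auto simp: distrib_left)
  also have "\<dots> = A 1 * Z 0 + (LINT t|unit_lebesgue. g t * C t)"
    using g iC by (simp add: A_def integrable_unit_integral)
  finally have 2: "(LINT t|unit_lebesgue. g t * Z t) = \<dots>" .
  have "(LINT t|unit_lebesgue. A t * h t) + (LINT t|unit_lebesgue. g t * C t) = A 1 * C 1"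
    using fubini_triangle[OF g h] iA iC by (simp add: A_def C_def)
  then have "(LINT t|unit_lebesgue. Y t * h t) + (LINT t|unit_lebesgue. g t * Z t)
      = Y 0 * C 1 + A 1 * Z 0 + A 1 * C 1"
    unfolding 1 2 by (simp add: algebra_simps)
  also have "\<dots> = Y 1 * Z 1 - Y 0 * Z 0"
    using Yt[of 1] Zt[of 1] by (simp add: algebra_simps)
  finally show ?thesis .
qed

lemma C1_primitive_of:
  fixes \<phi> :: "real \<Rightarrow> complex"
  assumes "\<phi> C1_differentiable_on UNIV"
  shows "primitive_of \<phi> (\<lambda>t. vector_derivative \<phi> (at t))"
proof -
  have c: "continuous_on UNIV (\<lambda>t. vector_derivative \<phi> (at t))"
    and d: "\<And>t. (\<phi> has_vector_derivative vector_derivative \<phi> (at t)) (at t)"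
    using assms by (auto simp: C1_differentiable_on_eq vector_derivative_works[symmetric])
  have "integral {0..t} (\<lambda>t. vector_derivative \<phi> (at t)) = \<phi> t - \<phi> 0" if "0 \<le> t" for t
    using fundamental_theorem_of_calculus[OF that, of \<phi> "\<lambda>t. vector_derivative \<phi> (at t)"] d
    by (simp add: has_vector_derivative_at_within integral_unique)
  then show ?thesis
    unfolding primitive_of_def
    using continuous_imp_integrable_real[OF continuous_on_subset[OF c, of "{0..1}"]]
    by (simp add: algebra_simps)
qed

lemma primitive_of_cnj:
  assumes "primitive_of Y g"
  shows "primitive_of (\<lambda>t. cnj (Y t)) (\<lambda>t. cnj (g t))"
proof -
  have g: "integrable unit_lebesgue g" and Y: "\<And>t. t \<in> {0..1} \<Longrightarrow> Y t = Y 0 + integral {0..t} g"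
    using assms unfolding primitive_of_def by blast+
  show ?thesis unfolding primitive_of_def
  proof safe
    show "integrable unit_lebesgue (\<lambda>t. cnj (g t))" using g by simp
    fix t :: real assume "t \<in> {0..1}"
    from Y[OF this] show "cnj (Y t) = cnj (Y 0) + integral {0..t} (\<lambda>t. cnj (g t))"
      by (simp add: integral_cnj)
  qed
qed

lemma primitive_of_imp_has_weak_deriv:
  assumes "primitive_of Y g"
  shows "has_weak_deriv Y g"
  unfolding has_weak_deriv_def
proof safe
  fix \<phi> assume t: "test_function \<phi>"
  then obtain a b where "0 < a" "b < 1" "\<forall>t. t \<notin> {a..b} \<longrightarrow> \<phi> t = 0"
    and c: "\<phi> C1_differentiable_on UNIV"
    unfolding test_function_def by blast
  then have "\<phi> 0 = 0" "\<phi> 1 = 0" by auto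
  with integration_by_parts_primitive[OF assms C1_primitive_of[OF c]]
  show "(LINT t|unit_lebesgue. Y t * vector_derivative \<phi> (at t)) = - (LINT t|unit_lebesgue. g t * \<phi> t)"
    by (simp add: eq_neg_iff_add_eq_0)
qed

section \<open>Test functions and the lemma of du Bois-Reymond\<close>

lemma has_real_derivative_pos_part_square:
  "((\<lambda>x::real. (max 0 x)\<^sup>2) has_real_derivative 2 * max 0 x) (at x)"
proof (rule linorder_cases[of x 0])
  assume x: "x < 0"
  have "((\<lambda>_. 0) has_real_derivative 2 * max 0 x) (at x)"
    using x by (auto intro!: derivative_eq_intros)
  then show ?thesis
    by (rule has_field_derivative_transform_within_open[of _ _ _ "{..<0}"]) (use x in auto)
next
  assume x: "0 < x"
  have "((\<lambda>x. x\<^sup>2) has_real_derivative 2 * max 0 x) (at x)"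
    using x by (auto intro!: derivative_eq_intros)
  then show ?thesis
    by (rule has_field_derivative_transform_within_open[of _ _ _ "{0<..}"]) (use x in auto)
next
  assume x: "x = 0"
  have "(\<lambda>h::real. (max 0 h)\<^sup>2 / h) \<midarrow>0\<rightarrow> 0"
  proof (rule Lim_null_comparison)
    show "\<forall>\<^sub>F h in at (0::real). norm ((max 0 h)\<^sup>2 / h) \<le> \<bar>h\<bar>"
      by (intro always_eventually) (auto simp: max_def power2_eq_square)
    show "((\<lambda>h::real. \<bar>h\<bar>) \<longlongrightarrow> 0) (at 0)"
      using tendsto_rabs[OF tendsto_ident_at[of "0::real" UNIV]] by simp
  qed
  then show ?thesis using x by (simp add: DERIV_def)
qed

text \<open>
  For \<open>0 < e < 1/2\<close> a continuously differentiable function that is positive on \<open>(e, 1 - e)\<close> and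
  vanishes elsewhere; \<open>bump 0\<close>, the limit for \<open>e \<longlonglongrightarrow> 0\<close>, is positive on all of \<open>(0,1)\<close>.
\<close>

definition bump :: "real \<Rightarrow> real \<Rightarrow> real" where
  "bump e t = (max 0 ((t - e) * (1 - e - t)))\<^sup>2"

lemma test_function_bump_times:
  fixes p :: "real \<Rightarrow> complex"
  assumes e: "0 < e" "e < 1/2" and p: "p C1_differentiable_on UNIV"
  shows "test_function (\<lambda>t. of_real (bump e t) * p t)"
  unfolding test_function_def
proof (intro conjI exI allI impI)
  have "bump e C1_differentiable_on UNIV"
    unfolding C1_differentiable_on_def
  proof (intro exI conjI ballI)
    fix t
    show "(bump e has_vector_derivative (2 * max 0 ((t - e) * (1 - e - t)) * (1 - 2 * t))) (at t)"
      unfolding bump_def has_real_derivative_iff_has_vector_derivative[symmetric]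
      by (rule DERIV_chain2[OF has_real_derivative_pos_part_square])
         (auto intro!: derivative_eq_intros)
    show "continuous_on UNIV (\<lambda>t. 2 * max 0 ((t - e) * (1 - e - t)) * (1 - 2 * t))"
      by (intro continuous_intros)
  qed
  then have "(\<lambda>t. bump e t *\<^sub>R p t) C1_differentiable_on UNIV"
    using p by simp
  then show "(\<lambda>t. of_real (bump e t) * p t) C1_differentiable_on UNIV"
    by (simp add: scaleR_conv_of_real)
  show "0 < e" "1 - e < 1" using e by auto
  fix t assume "t \<notin> {e..1 - e}"
  then have "(t - e) * (1 - e - t) \<le> 0"
    using e by (auto simp: mult_le_0_iff)
  then show "of_real (bump e t) * p t = 0" by (simp add: bump_def)
qed

lemma bump_bounds:
  assumes "0 < e" "e < 1/2" "t \<in> {0..1}"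
  shows "0 \<le> bump e t" "bump e t \<le> 1"
proof -
  show "0 \<le> bump e t" by (simp add: bump_def)
  have "(t - e) * (1 - e - t) \<le> 1"
  proof (cases "t \<in> {e..1 - e}")
    case True
    then show ?thesis using assms by (intro mult_le_one) auto
  next
    case False
    then have "(t - e) * (1 - e - t) \<le> 0"
      using assms by (auto simp: mult_le_0_iff)
    then show ?thesis by simp
  qed
  then show "bump e t \<le> 1" by (simp add: bump_def power_le_one)
qed

lemma AE_unit_not_in_negligible:
  assumes "negligible N"
  shows "AE t in unit_lebesgue. t \<notin> N"
proof -
  have "AE t in lebesgue. t \<notin> N"
    using assms by (intro AE_not_in) (simp add: negligible_iff_null_sets)
  then have "AE t in lebesgue. t \<in> {0..1} \<longrightarrow> t \<notin> N"
    by eventually_elim simp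
  then show ?thesis by (simp add: AE_restrict_space_iff)
qed

text \<open>
  The function \<open>s = cnj w / \<bar>w\<bar>\<close> is an almost everywhere limit of continuous functions.
  Truncated to the unit disc and approximated by polynomials, these become uniformly bounded
  functions \<open>p n\<close> of class \<open>C\<^sup>1\<close>, and \<open>bump (e n) * p n\<close> with \<open>e n \<longlonglongrightarrow> 0\<close> are test functions.  By
  dominated convergence the integral of \<open>bump 0 * \<bar>w\<bar>\<close> vanishes.  Multiplying by \<open>bump\<close> rather than
  by cutoffs that tend to \<open>1\<close> is harmless, because \<open>bump 0\<close> is positive on \<open>(0,1)\<close>.
\<close>

lemma du_Bois_Reymond:
  assumes w: "integrable unit_lebesgue w"
    and orth: "\<And>\<phi>. test_function \<phi> \<Longrightarrow> (LINT t|unit_lebesgue. w t * \<phi> t) = 0"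
  shows "AE t in unit_lebesgue. w t = 0"
proof -
  have wm[measurable]: "w \<in> borel_measurable unit_lebesgue" using w by simp
  define s where "s t = cnj (w t) / of_real (cmod (w t))" for t
  have [measurable]: "(\<lambda>t. cnj (w t)) \<in> borel_measurable unit_lebesgue"
    using w by (intro borel_measurable_integrable) simp
  have "s t = (1 / cmod (w t)) *\<^sub>R cnj (w t)" for t
    by (simp add: s_def scaleR_conv_of_real)
  then have "s = (\<lambda>t. (1 / cmod (w t)) *\<^sub>R cnj (w t))" by blast
  then have [measurable]: "s \<in> borel_measurable unit_lebesgue"
    by simp
  then have "s measurable_on {0..1}"
    by (simp add: measurable_on_iff_borel_measurable)
  then obtain N g where N: "negligible N" and gc: "\<And>n. continuous_on UNIV (g n)"
    and glim: "\<And>t. t \<notin> N \<Longrightarrow> (\<lambda>n. g n t) \<longlonglongrightarrow> (if t \<in> {0..1} then s t else 0)"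
    unfolding measurable_on_def by blast
  have s1: "cmod (s t) \<le> 1" for t by (simp add: s_def norm_divide)
  \<comment> \<open>The retraction onto the unit disc fixes \<open>s\<close>, hence keeps the limit.\<close>
  define c where "c n t = g n t / of_real (max 1 (cmod (g n t)))" for n t
  have cc: "continuous_on {0..1} (c n)" for n
    unfolding c_def using continuous_on_subset[OF gc]
    by (intro continuous_intros) (auto simp: max_def)
  have c1: "cmod (c n t) \<le> 1" for n t
    by (simp add: c_def norm_divide divide_simps)
  have "\<exists>p. polynomial_function p \<and> (\<forall>t\<in>{0..1}. cmod (c n t - p t) < 1 / Suc n)" for n
    by (rule Stone_Weierstrass_polynomial_function[OF _ cc]) auto
  then obtain p where pp: "\<And>n. polynomial_function (p n)"
    and p: "\<And>n t. t \<in> {0..1} \<Longrightarrow> cmod (c n t - p n t) < 1 / Suc n" by metis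
  have plim: "(\<lambda>n. p n t) \<longlonglongrightarrow> s t" if "t \<notin> N" "t \<in> {0..1}" for t
  proof -
    have "(\<lambda>n. g n t) \<longlonglongrightarrow> s t" using glim[OF that(1)] that(2) by simp
    then have "(\<lambda>n. c n t) \<longlonglongrightarrow> s t / of_real (max 1 (cmod (s t)))"
      unfolding c_def by (intro tendsto_intros) (auto simp: max_def)
    then have "(\<lambda>n. c n t) \<longlonglongrightarrow> s t" using s1[of t] by (simp add: max_absorb1)
    moreover have "(\<lambda>n. c n t - p n t) \<longlonglongrightarrow> 0"
    proof (rule Lim_null_comparison)
      show "\<forall>\<^sub>F n in sequentially. cmod (c n t - p n t) \<le> 1 / Suc n"
        using p[OF that(2)] by (intro always_eventually) (auto intro: less_imp_le)
      show "(\<lambda>n. 1 / real (Suc n)) \<longlonglongrightarrow> 0"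
        using LIMSEQ_inverse_real_of_nat by (simp add: inverse_eq_divide)
    qed
    ultimately have "(\<lambda>n. c n t - (c n t - p n t)) \<longlonglongrightarrow> s t - 0"
      by (rule tendsto_diff)
    then show ?thesis by simp
  qed
  have p2: "cmod (p n t) \<le> 2" if "t \<in> {0..1}" for n t
  proof -
    have "1 / Suc n \<le> (1::real)" by simp
    moreover have "cmod (p n t) \<le> cmod (c n t) + cmod (c n t - p n t)"
      using norm_triangle_sub[of "p n t" "c n t"] by (simp add: norm_minus_commute)
    ultimately show ?thesis using c1[of n t] p[OF that, of n] by linarith
  qed
  have pC1: "p n C1_differentiable_on UNIV" for n
  proof -
    obtain p' where "polynomial_function p'" "\<And>t. (p n has_vector_derivative p' t) (at t)"
      using has_vector_derivative_polynomial_function[OF pp] by metis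
    then show ?thesis unfolding C1_differentiable_on_def
      using continuous_on_polymonial_function by blast
  qed
  \<comment> \<open>The shift by \<open>3\<close> makes \<open>e n < 1/2\<close> for all \<open>n\<close>.\<close>
  define e where "e n = 1 / real (n + 3)" for n
  have e: "0 < e n" "e n < 1/2" for n by (auto simp: e_def divide_simps)
  have elim: "e \<longlonglongrightarrow> 0"
    unfolding e_def by (rule LIMSEQ_ignore_initial_segment[OF lim_1_over_n, of 3])
  define \<psi> where "\<psi> n t = of_real (bump (e n) t) * p n t" for n t
  have test: "test_function (\<psi> n)" for n
    unfolding \<psi>_def by (rule test_function_bump_times[OF e pC1])
  have \<psi>m[measurable]: "\<psi> n \<in> borel_measurable unit_lebesgue" for n
    using primitive_of_continuous[OF C1_primitive_of] test[of n]
    by (intro continuous_measurable_unit) (auto simp: test_function_def)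
  have "(\<lambda>n. LINT t|unit_lebesgue. w t * \<psi> n t)
     \<longlonglongrightarrow> (LINT t|unit_lebesgue. w t * (of_real (bump 0 t) * s t))"
  proof (rule integral_dominated_convergence)
    show "(\<lambda>t. w t * (of_real (bump 0 t) * s t)) \<in> borel_measurable unit_lebesgue"
    proof -
      have "(\<lambda>t. complex_of_real (bump 0 t)) \<in> borel_measurable unit_lebesgue"
        unfolding bump_def by (intro continuous_measurable_unit continuous_intros)
      then show ?thesis by measurable
    qed
    show "(\<lambda>t. w t * \<psi> n t) \<in> borel_measurable unit_lebesgue" for n by measurable
    show "integrable unit_lebesgue (\<lambda>t. 2 * cmod (w t))" using w by simp
    show "AE t in unit_lebesgue. norm (w t * \<psi> n t) \<le> 2 * cmod (w t)" for n
    proof (rule AE_I2)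
      fix t assume "t \<in> space unit_lebesgue"
      then have t: "t \<in> {0..1}" by simp
      have "cmod (\<psi> n t) \<le> 1 * 2"
        unfolding \<psi>_def norm_mult
        using bump_bounds[of "e n" t] e[of n] t p2[OF t, of n] by (intro mult_mono) auto
      then show "norm (w t * \<psi> n t) \<le> 2 * cmod (w t)"
        using mult_left_mono[of "cmod (\<psi> n t)" 2 "cmod (w t)"] by (simp add: norm_mult mult.commute)
    qed
    show "AE t in unit_lebesgue. (\<lambda>n. w t * \<psi> n t) \<longlonglongrightarrow> w t * (of_real (bump 0 t) * s t)"
    proof (rule AE_mp[OF AE_unit_not_in_negligible[OF N]], intro AE_I2 impI)
      fix t assume "t \<in> space unit_lebesgue" "t \<notin> N"
      then have pt: "(\<lambda>n. p n t) \<longlonglongrightarrow> s t" by (intro plim) auto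
      have "(\<lambda>n. bump (e n) t) \<longlonglongrightarrow> bump 0 t"
        unfolding bump_def by (intro tendsto_power tendsto_max tendsto_mult tendsto_diff tendsto_const elim)
      then show "(\<lambda>n. w t * \<psi> n t) \<longlonglongrightarrow> w t * (of_real (bump 0 t) * s t)"
        unfolding \<psi>_def by (intro tendsto_mult tendsto_const tendsto_of_real pt)
    qed
  qed
  moreover have "(LINT t|unit_lebesgue. w t * \<psi> n t) = 0" for n
    by (rule orth[OF test])
  ultimately have 0: "(LINT t|unit_lebesgue. w t * (of_real (bump 0 t) * s t)) = 0"
    by (simp add: LIMSEQ_const_iff)
  have eq: "w t * (of_real (bump 0 t) * s t) = of_real (bump 0 t * cmod (w t))" for t
  proof (cases "w t = 0")
    case False
    then show ?thesis
      using complex_norm_square[of "w t", symmetric]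
      by (simp add: s_def power2_eq_square mult.left_commute[of "w t"])
  qed simp
  have i: "integrable unit_lebesgue (\<lambda>t. bump 0 t * cmod (w t))"
  proof -
    have "integrable unit_lebesgue (\<lambda>t. complex_of_real (bump 0 t) * w t)"
      unfolding bump_def by (intro integrable_continuous_times w continuous_intros)
    then have "integrable unit_lebesgue (\<lambda>t. cmod (complex_of_real (bump 0 t) * w t))"
      by (rule integrable_norm)
    then show ?thesis by (simp add: norm_mult norm_power bump_def)
  qed
  have "complex_of_real (LINT t|unit_lebesgue. bump 0 t * cmod (w t)) = 0"
    using 0 unfolding eq integral_complex_of_real .
  then have "AE t in unit_lebesgue. bump 0 t * cmod (w t) = 0"
    using integral_nonneg_eq_0_iff_AE[OF i] by (simp add: bump_def)
  moreover have "AE t in unit_lebesgue. t \<in> {0<..<1}"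
    by (rule AE_mp[OF AE_unit_not_in_negligible[of "{0, 1}"]], simp, intro AE_I2 impI) auto
  ultimately show ?thesis
  proof eventually_elim
    case (elim t)
    then have "0 < t * (1 - t)" by simp
    with elim show ?case by (auto simp: bump_def max_def)
  qed
qed

section \<open>Weak derivatives\<close>

lemma test_functionE:
  assumes "test_function \<phi>"
  obtains a b where "0 < a" "b < 1" "\<And>t. t \<notin> {a..b} \<Longrightarrow> \<phi> t = 0"
    "\<phi> C1_differentiable_on UNIV"
  using assms unfolding test_function_def by metis

lemma test_function_continuous:
  assumes "test_function \<phi>"
  shows "continuous_on S \<phi>" "continuous_on S (\<lambda>t. vector_derivative \<phi> (at t))"
proof -
  have "\<phi> C1_differentiable_on UNIV" using assms by (simp add: test_function_def)
  then have "continuous_on UNIV \<phi> \<and> continuous_on UNIV (\<lambda>t. vector_derivative \<phi> (at t))"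
    by (simp add: C1_differentiable_imp_continuous_on) (simp add: C1_differentiable_on_eq)
  then show "continuous_on S \<phi>" "continuous_on S (\<lambda>t. vector_derivative \<phi> (at t))"
    using continuous_on_subset by blast+
qed

lemma integrable_test_function:
  assumes "test_function \<phi>"
  shows "integrable unit_lebesgue \<phi>"
  by (rule continuous_imp_integrable_real[OF test_function_continuous(1)[OF assms]])

lemma integrable_mult_test_function:
  assumes "test_function \<phi>" "integrable unit_lebesgue w"
  shows "integrable unit_lebesgue (\<lambda>t. w t * \<phi> t)"
    "integrable unit_lebesgue (\<lambda>t. w t * vector_derivative \<phi> (at t))"
  using integrable_continuous_times[OF test_function_continuous(1)[OF assms(1)] assms(2)]
    integrable_continuous_times[OF test_function_continuous(2)[OF assms(1)] assms(2)]
  by (simp_all add: mult.commute)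

text \<open>The derivatives of test functions include all continuous functions of mean zero that vanish
  near the ends of the interval.\<close>

lemma test_function_antiderivative:
  fixes \<psi> :: "real \<Rightarrow> complex"
  assumes c: "continuous_on UNIV \<psi>" and ab: "0 < a" "b < 1"
    and z: "\<And>t. t \<notin> {a..b} \<Longrightarrow> \<psi> t = 0"
    and mean: "(LINT t|unit_lebesgue. \<psi> t) = 0"
  obtains \<phi> where "test_function \<phi>" "\<And>t. vector_derivative \<phi> (at t) = \<psi> t"
proof -
  \<comment> \<open>For \<open>t < 0\<close> the interval is empty and \<open>\<phi> t = 0\<close>.\<close>
  define \<phi> where "\<phi> t = integral {0..t} \<psi>" for t
  have cs: "continuous_on S \<psi>" for S using c continuous_on_subset by blast
  have left: "\<phi> t = 0" if "t < a" for t
  proof -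
    have "integral {0..t} \<psi> = integral {0..t} (\<lambda>_. 0)"
      by (rule Henstock_Kurzweil_Integration.integral_cong) (use that z in auto)
    then show ?thesis by (simp add: \<phi>_def)
  qed
  have "\<phi> 1 = 0"
    using mean integrable_unit_integral[OF continuous_imp_integrable_real[OF cs]] by (simp add: \<phi>_def)
  have right: "\<phi> t = 0" if t: "max 0 b < t" for t
  proof -
    \<comment> \<open>\<open>b\<close> may be negative, if \<open>\<psi>\<close> vanishes identically.\<close>
    define m where "m = max 0 b"
    have m: "0 \<le> m" "m < t" "m < 1" "b \<le> m" using t ab by (auto simp: m_def)
    have *: "\<phi> s = integral {0..m} \<psi>" if "m < s" for s
    proof -
      have "integral {0..m} \<psi> + integral {m..s} \<psi> = \<phi> s"
        unfolding \<phi>_def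
        by (rule Henstock_Kurzweil_Integration.integral_combine)
           (use m that in \<open>auto intro: integrable_continuous_real cs\<close>)
      moreover have "integral {m..s} \<psi> = integral {m..s} (\<lambda>_. 0)"
        by (rule integral_spike[of "{m}"]) (use z m in auto)
      ultimately show ?thesis by simp
    qed
    show ?thesis using *[of t] *[of 1] m \<open>\<phi> 1 = 0\<close> by simp
  qed
  have d: "(\<phi> has_vector_derivative \<psi> t) (at t)" for t
  proof (cases "t < a")
    case True
    have "((\<lambda>_. 0) has_vector_derivative \<psi> t) (at t)"
      using z[of t] True by simp
    then show ?thesis
      by (rule has_vector_derivative_transform_within_open[of _ _ _ "{..<a}"])
         (use True left in auto)
  next
    case False
    have "((\<lambda>u. integral {0..u} \<psi>) has_vector_derivative \<psi> t) (at t within {0..t+1})"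
      by (rule integral_has_vector_derivative[OF cs]) (use False ab in auto)
    then have "(\<phi> has_vector_derivative \<psi> t) (at t within {0<..<t+1})"
      unfolding \<phi>_def[abs_def] by (rule has_vector_derivative_within_subset) auto
    then show ?thesis
      by (subst (asm) has_vector_derivative_within_open) (use False ab in auto)
  qed
  show thesis
  proof
    show "vector_derivative \<phi> (at t) = \<psi> t" for t by (rule vector_derivative_at[OF d])
    show "test_function \<phi>" unfolding test_function_def
    proof (intro conjI exI allI impI)
      show "\<phi> C1_differentiable_on UNIV"
        unfolding C1_differentiable_on_def using d c by blast
      show "0 < a" "max 0 b < 1" using ab by auto
      show "\<phi> t = 0" if "t \<notin> {a..max 0 b}" for t
        using left right that by (meson atLeastAtMost_iff not_le)
    qed
  qed
qed

text \<open>If all test functions had mean zero, then the constant \<open>1\<close> would vanish almost everywhere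
  by the lemma of du Bois-Reymond.\<close>

lemma test_function_nonzero_mean:
  obtains \<eta> where "test_function \<eta>" "(LINT t|unit_lebesgue. \<eta> t) \<noteq> 0"
proof -
  have "\<exists>\<eta>. test_function \<eta> \<and> (LINT t|unit_lebesgue. \<eta> t) \<noteq> 0"
  proof (rule ccontr)
    assume no: "\<not> ?thesis"
    have i: "integrable unit_lebesgue (\<lambda>_. 1::complex)"
      by (rule continuous_imp_integrable_real) simp
    have "AE t in unit_lebesgue. (1::complex) = 0"
      by (rule du_Bois_Reymond[OF i]) (use no in simp)
    then have "(LINT t|unit_lebesgue. 1::complex) = (LINT t|unit_lebesgue. 0)"
      by (intro integral_cong_AE) auto
    moreover have "(LINT t|unit_lebesgue. 1::complex) = 1"
      unfolding integrable_unit_integral[OF i, symmetric] by simp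
    ultimately show False by simp
  qed
  then show thesis using that by blast
qed

text \<open>
  Subtracting from a test function \<open>\<psi>\<close> a multiple of a fixed \<open>\<eta>\<close> with nonzero mean gives the
  derivative of a test function, against which \<open>w\<close> integrates to zero.  So \<open>w - c\<close> is orthogonal
  to all test functions, where \<open>c\<close> is the \<open>\<eta>\<close>-weighted mean of \<open>w\<close>.
\<close>

lemma weak_deriv_zero_imp_AE_constant:
  assumes w: "integrable unit_lebesgue w" and z: "has_weak_deriv w (\<lambda>_. 0)"
  obtains c where "AE t in unit_lebesgue. w t = c"
proof -
  obtain \<eta> where \<eta>: "test_function \<eta>" and I: "(LINT t|unit_lebesgue. \<eta> t) \<noteq> 0"
    using test_function_nonzero_mean by blast
  define I where "I = (LINT t|unit_lebesgue. \<eta> t)"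
  define c where "c = (LINT t|unit_lebesgue. w t * \<eta> t) / I"
  have I0: "I \<noteq> 0" using I by (simp add: I_def)
  have cst: "integrable unit_lebesgue (\<lambda>_. c)"
    by (rule continuous_imp_integrable_real) simp
  have wc: "integrable unit_lebesgue (\<lambda>t. w t - c)"
    using w cst by simp
  have "(LINT t|unit_lebesgue. (w t - c) * \<psi> t) = 0" if \<psi>: "test_function \<psi>" for \<psi>
  proof -
    define r where "r = (LINT t|unit_lebesgue. \<psi> t) / I"
    define \<psi>0 where "\<psi>0 t = \<psi> t - r * \<eta> t" for t
    obtain a b where ab: "0 < a" "b < 1" "\<And>t. t \<notin> {a..b} \<Longrightarrow> \<psi> t = 0"
      using \<psi> test_functionE by metis
    obtain a' b' where ab': "0 < a'" "b' < 1" "\<And>t. t \<notin> {a'..b'} \<Longrightarrow> \<eta> t = 0"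
      using \<eta> test_functionE by metis
    obtain \<phi> where \<phi>: "test_function \<phi>" "\<And>t. vector_derivative \<phi> (at t) = \<psi>0 t"
    proof (rule test_function_antiderivative[of \<psi>0 "min a a'" "max b b'"])
      show "continuous_on UNIV \<psi>0"
        unfolding \<psi>0_def by (intro continuous_intros test_function_continuous \<psi> \<eta>)
      show "0 < min a a'" "max b b' < 1" using ab ab' by auto
      show "\<psi>0 t = 0" if "t \<notin> {min a a'..max b b'}" for t
      proof -
        have "t \<notin> {a..b}" "t \<notin> {a'..b'}" using that by auto
        then show ?thesis using ab ab' by (simp add: \<psi>0_def)
      qed
      show "(LINT t|unit_lebesgue. \<psi>0 t) = 0"
        using integrable_test_function[OF \<psi>] integrable_test_function[OF \<eta>] I0
        by (simp add: \<psi>0_def r_def flip: I_def)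
    qed blast
    have 0: "(LINT t|unit_lebesgue. w t * \<psi>0 t) = 0"
      using z \<phi>(1) unfolding has_weak_deriv_def \<phi>(2)[symmetric] by simp
    have i: "integrable unit_lebesgue (\<lambda>t. w t * \<psi> t)" "integrable unit_lebesgue (\<lambda>t. w t * \<eta> t)"
      using integrable_mult_test_function(1) \<psi> \<eta> w by blast+
    have "(LINT t|unit_lebesgue. w t * \<psi>0 t)
      = (LINT t|unit_lebesgue. w t * \<psi> t - r * (w t * \<eta> t))"
      by (simp add: \<psi>0_def algebra_simps)
    also have "\<dots> = (LINT t|unit_lebesgue. w t * \<psi> t) - r * (LINT t|unit_lebesgue. w t * \<eta> t)"
      using i by simp
    finally have "(LINT t|unit_lebesgue. w t * \<psi> t) = r * (LINT t|unit_lebesgue. w t * \<eta> t)"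
      using 0 by simp
    also have "\<dots> = c * (LINT t|unit_lebesgue. \<psi> t)"
      by (simp add: r_def c_def)
    finally have "(LINT t|unit_lebesgue. w t * \<psi> t) - c * (LINT t|unit_lebesgue. \<psi> t) = 0"
      by simp
    then show ?thesis
      using i(1) integrable_test_function[OF \<psi>] by (simp add: left_diff_distrib)
  qed
  then have "AE t in unit_lebesgue. w t - c = 0"
    by (rule du_Bois_Reymond[OF wc])
  then show thesis using that by simp
qed

lemma weak_deriv_unique:
  assumes "integrable unit_lebesgue g" "integrable unit_lebesgue h"
    and "has_weak_deriv y g" "has_weak_deriv y h"
  shows "AE t in unit_lebesgue. g t = h t"
proof -
  have "AE t in unit_lebesgue. g t - h t = 0"
  proof (rule du_Bois_Reymond)
    show "integrable unit_lebesgue (\<lambda>t. g t - h t)" using assms by simp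
    fix \<phi> assume \<phi>: "test_function \<phi>"
    then have "- (LINT t|unit_lebesgue. g t * \<phi> t) = - (LINT t|unit_lebesgue. h t * \<phi> t)"
      using assms(3,4) unfolding has_weak_deriv_def by metis
    then show "(LINT t|unit_lebesgue. (g t - h t) * \<phi> t) = 0"
      using integrable_mult_test_function(1)[OF \<phi> assms(1)] integrable_mult_test_function(1)[OF \<phi> assms(2)]
      by (simp add: left_diff_distrib)
  qed
  then show ?thesis by simp
qed

text \<open>An integrable function with an integrable weak derivative has an absolutely continuous
  representative: it differs from an indefinite integral of its derivative by a function whose
  weak derivative is zero.\<close>

lemma weak_deriv_imp_primitive:
  assumes y: "integrable unit_lebesgue y" and g: "integrable unit_lebesgue g"
    and "has_weak_deriv y g"
  obtains Y where "primitive_of Y g" "AE t in unit_lebesgue. Y t = y t"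
proof -
  define G where "G t = integral {0..t} g" for t
  have pG: "primitive_of G g" using g by (simp add: primitive_of_def G_def)
  have iG: "integrable unit_lebesgue G"
    by (rule continuous_imp_integrable_real[OF primitive_of_continuous[OF pG]])
  have "has_weak_deriv (\<lambda>t. y t - G t) (\<lambda>_. 0)"
    unfolding has_weak_deriv_def
  proof safe
    fix \<phi> assume \<phi>: "test_function \<phi>"
    have "(LINT t|unit_lebesgue. y t * vector_derivative \<phi> (at t))
        = (LINT t|unit_lebesgue. G t * vector_derivative \<phi> (at t))"
      using assms(3) primitive_of_imp_has_weak_deriv[OF pG] \<phi> by (simp add: has_weak_deriv_def)
    then show "(LINT t|unit_lebesgue. (y t - G t) * vector_derivative \<phi> (at t))
        = - (LINT t|unit_lebesgue. 0 * \<phi> t)"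
      using integrable_mult_test_function(2)[OF \<phi> y] integrable_mult_test_function(2)[OF \<phi> iG]
      by (simp add: left_diff_distrib)
  qed
  then obtain c where c: "AE t in unit_lebesgue. y t - G t = c"
    using weak_deriv_zero_imp_AE_constant y iG Bochner_Integration.integrable_diff by metis
  show thesis
  proof
    show "primitive_of (\<lambda>t. c + G t) g"
      using g by (simp add: primitive_of_def G_def)
    show "AE t in unit_lebesgue. c + G t = y t"
      using c by eventually_elim auto
  qed
qed

section \<open>Square integrable functions\<close>

lemma L2_measurable: "y \<in> L2 \<Longrightarrow> y \<in> borel_measurable unit_lebesgue"
  by (simp add: L2_def)

lemma L2_product_integrable:
  assumes "y \<in> L2" "z \<in> L2"
  shows "integrable unit_lebesgue (\<lambda>t. y t * z t)"
proof (rule Bochner_Integration.integrable_bound)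
  have [measurable]: "y \<in> borel_measurable unit_lebesgue" "z \<in> borel_measurable unit_lebesgue"
    using assms by (auto intro: L2_measurable)
  show "integrable unit_lebesgue (\<lambda>t. (cmod (y t))\<^sup>2 + (cmod (z t))\<^sup>2)"
    using assms by (auto simp: L2_def)
  show "(\<lambda>t. y t * z t) \<in> borel_measurable unit_lebesgue" by measurable
  have "cmod (y t * z t) \<le> (cmod (y t))\<^sup>2 + (cmod (z t))\<^sup>2" for t
    unfolding norm_mult
    using sum_squares_bound[of "cmod (y t)" "cmod (z t)"] mult_nonneg_nonneg[OF norm_ge_zero norm_ge_zero, of "y t" "z t"]
    by linarith
  then show "AE t in unit_lebesgue. norm (y t * z t) \<le> norm ((cmod (y t))\<^sup>2 + (cmod (z t))\<^sup>2)"
    by (intro AE_I2) simp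
qed

lemma continuous_in_L2:
  assumes "continuous_on {0..1} y"
  shows "y \<in> L2"
  unfolding L2_def
  using assms continuous_measurable_unit[OF assms]
  by (auto intro!: continuous_imp_integrable_real continuous_intros)

lemma L2_integrable:
  assumes "y \<in> L2"
  shows "integrable unit_lebesgue y"
  using L2_product_integrable[OF assms continuous_in_L2[of "\<lambda>_. 1"]] by simp

lemma L2_dominated:
  assumes y: "y \<in> L2" and m: "z \<in> borel_measurable unit_lebesgue"
    and b: "AE t in unit_lebesgue. cmod (z t) \<le> C * cmod (y t)"
  shows "z \<in> L2"
proof -
  have "integrable unit_lebesgue (\<lambda>t. (cmod (z t))\<^sup>2)"
  proof (rule Bochner_Integration.integrable_bound)
    show "integrable unit_lebesgue (\<lambda>t. C\<^sup>2 * (cmod (y t))\<^sup>2)"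
      using y by (simp add: L2_def)
    show "(\<lambda>t. (cmod (z t))\<^sup>2) \<in> borel_measurable unit_lebesgue" using m by measurable
    show "AE t in unit_lebesgue. norm ((cmod (z t))\<^sup>2) \<le> norm (C\<^sup>2 * (cmod (y t))\<^sup>2)"
      using b
    proof eventually_elim
      case (elim t)
      then have "(cmod (z t))\<^sup>2 \<le> (C * cmod (y t))\<^sup>2" by (rule power_mono) simp
      then show ?case by (simp add: power_mult_distrib)
    qed
  qed
  then show ?thesis using m by (simp add: L2_def)
qed

lemma L2_cmult: "y \<in> L2 \<Longrightarrow> (\<lambda>t. c * y t) \<in> L2"
  by (rule L2_dominated[of y _ "cmod c"]) (auto simp: norm_mult dest: L2_measurable)

lemma L2_cnj: "y \<in> L2 \<Longrightarrow> (\<lambda>t. cnj (y t)) \<in> L2"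
proof -
  assume y: "y \<in> L2"
  then have "(\<lambda>t. cnj (y t)) \<in> borel_measurable unit_lebesgue"
    using L2_integrable by (intro borel_measurable_integrable) simp
  then show ?thesis by (rule L2_dominated[OF y, of _ 1]) simp
qed

lemma L2_bounded_mult:
  assumes q: "essentially_bounded q" and y: "y \<in> L2"
  shows "(\<lambda>t. complex_of_real (q t) * y t) \<in> L2"
proof -
  have [measurable]: "q \<in> borel_measurable unit_lebesgue" "y \<in> borel_measurable unit_lebesgue"
    using q y by (auto simp: essentially_bounded_def dest: L2_measurable)
  have m: "(\<lambda>t. complex_of_real (q t) * y t) \<in> borel_measurable unit_lebesgue"
    unfolding scaleR_conv_of_real[symmetric] by measurable
  obtain C where "AE t in unit_lebesgue. \<bar>q t\<bar> \<le> C"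
    using q by (auto simp: essentially_bounded_def)
  then have "AE t in unit_lebesgue. cmod (complex_of_real (q t) * y t) \<le> C * cmod (y t)"
    by eventually_elim (simp add: norm_mult mult_right_mono)
  then show ?thesis by (rule L2_dominated[OF y m])
qed

lemma L2_diff:
  assumes y: "y \<in> L2" and z: "z \<in> L2"
  shows "(\<lambda>t. y t - z t) \<in> L2"
proof -
  have [measurable]: "y \<in> borel_measurable unit_lebesgue" "z \<in> borel_measurable unit_lebesgue"
    using assms by (auto dest: L2_measurable)
  have i: "integrable unit_lebesgue (\<lambda>t. 2 * (cmod (y t))\<^sup>2 + 2 * (cmod (z t))\<^sup>2)"
    using assms by (auto simp: L2_def)
  have "integrable unit_lebesgue (\<lambda>t. (cmod (y t - z t))\<^sup>2)"
  proof (rule Bochner_Integration.integrable_bound[OF i])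
    show "AE t in unit_lebesgue. norm ((cmod (y t - z t))\<^sup>2) \<le> norm (2 * (cmod (y t))\<^sup>2 + 2 * (cmod (z t))\<^sup>2)"
    proof (rule AE_I2)
      fix t
      have "(cmod (y t - z t))\<^sup>2 \<le> (cmod (y t) + cmod (z t))\<^sup>2"
        by (rule power_mono[OF norm_triangle_ineq4]) simp
      also have "\<dots> \<le> 2 * (cmod (y t))\<^sup>2 + 2 * (cmod (z t))\<^sup>2"
        using sum_squares_bound[of "cmod (y t)" "cmod (z t)"] by (simp add: power2_sum)
      finally show "norm ((cmod (y t - z t))\<^sup>2) \<le> norm (2 * (cmod (y t))\<^sup>2 + 2 * (cmod (z t))\<^sup>2)"
        by simp
    qed
  qed measurable
  then show ?thesis by (simp add: L2_def)
qed

section \<open>Representatives of Sobolev functions\<close>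

lemma continuous_AE_eq:
  fixes Y Z :: "real \<Rightarrow> complex"
  assumes Y: "continuous_on {0..1} Y" and Z: "continuous_on {0..1} Z"
    and eq: "AE t in unit_lebesgue. Y t = Z t" and t: "t \<in> {0..1}"
  shows "Y t = Z t"
proof -
  have c: "continuous_on {0..1} (\<lambda>t. cmod (Y t - Z t))"
    using Y Z by (intro continuous_intros)
  then have i: "integrable unit_lebesgue (\<lambda>t. cmod (Y t - Z t))"
    by (rule continuous_imp_integrable_real)
  have "(LINT t|unit_lebesgue. cmod (Y t - Z t)) = 0"
    using eq by (intro integral_eq_zero_AE) (auto elim: eventually_mono)
  then have "((\<lambda>t. cmod (Y t - Z t)) has_integral 0) (cbox 0 1)"
    using has_integral_integral_lebesgue_on[OF i] by simp
  then have "cmod (Y t - Z t) = 0"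
    by (rule has_integral_0_cbox_imp_0[rotated 2]) (use c t in \<open>auto simp: box_real\<close>)
  then show ?thesis by simp
qed

lemma has_weak_deriv_cong_AE:
  assumes "y \<in> borel_measurable unit_lebesgue" "z \<in> borel_measurable unit_lebesgue"
    and eq: "AE t in unit_lebesgue. y t = z t"
  shows "has_weak_deriv y g \<longleftrightarrow> has_weak_deriv z g"
proof -
  have "(LINT t|unit_lebesgue. y t * vector_derivative \<phi> (at t))
      = (LINT t|unit_lebesgue. z t * vector_derivative \<phi> (at t))" if "test_function \<phi>" for \<phi>
  proof (rule integral_cong_AE)
    have [measurable]: "(\<lambda>t. vector_derivative \<phi> (at t)) \<in> borel_measurable unit_lebesgue"
      by (rule continuous_measurable_unit[OF test_function_continuous(2)[OF that]])
    show "(\<lambda>t. y t * vector_derivative \<phi> (at t)) \<in> borel_measurable unit_lebesgue"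
      "(\<lambda>t. z t * vector_derivative \<phi> (at t)) \<in> borel_measurable unit_lebesgue"
      using assms by measurable
    show "AE t in unit_lebesgue. y t * vector_derivative \<phi> (at t) = z t * vector_derivative \<phi> (at t)"
      using eq by eventually_elim simp
  qed
  then show ?thesis unfolding has_weak_deriv_def by auto
qed

text \<open>The chosen derivative \<^term>\<open>wderiv y\<close> and the chosen representative \<^term>\<open>pt_value y\<close> have the
  properties that the choice operator was to secure, and they agree with any other candidate,
  almost everywhere and everywhere on \<open>[0,1]\<close>, respectively.\<close>

lemma wderiv_props:
  assumes "y \<in> sobolev 1"
  shows "wderiv y \<in> L2" "has_weak_deriv y (wderiv y)"
proof -
  have "\<exists>g. g \<in> L2 \<and> has_weak_deriv y g" using assms by auto
  then have "wderiv y \<in> L2 \<and> has_weak_deriv y (wderiv y)"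
    unfolding wderiv_def by (rule someI_ex)
  then show "wderiv y \<in> L2" "has_weak_deriv y (wderiv y)" by auto
qed

lemma wderiv_AE_eq:
  assumes "y \<in> L2" "g \<in> L2" "has_weak_deriv y g"
  shows "AE t in unit_lebesgue. wderiv y t = g t"
proof -
  have "y \<in> sobolev 1" using assms by auto
  from wderiv_props[OF this] show ?thesis
    using assms by (intro weak_deriv_unique[of _ _ y] L2_integrable)
qed

lemma pt_value_props:
  assumes c: "continuous_on {0..1} Y" and eq: "AE t in unit_lebesgue. Y t = y t"
  shows "AE t in unit_lebesgue. pt_value y t = y t"
    and "t \<in> {0..1} \<Longrightarrow> pt_value y t = Y t"
proof -
  have "continuous_on {0..1} (pt_value y) \<and> (AE t in unit_lebesgue. pt_value y t = y t)"
    unfolding pt_value_def by (rule someI[of _ Y]) (use assms in simp)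
  then have p: "continuous_on {0..1} (pt_value y)" "AE t in unit_lebesgue. pt_value y t = y t" by auto
  show "AE t in unit_lebesgue. pt_value y t = y t" by (rule p)
  have "AE t in unit_lebesgue. pt_value y t = Y t"
    using p(2) eq by eventually_elim simp
  then show "t \<in> {0..1} \<Longrightarrow> pt_value y t = Y t"
    by (rule continuous_AE_eq[OF p(1) c])
qed

lemma sobolev_1_primitive:
  assumes "y \<in> sobolev 1"
  shows "primitive_of (pt_value y) (wderiv y)" "AE t in unit_lebesgue. pt_value y t = y t"
proof -
  have y: "y \<in> L2" using assms by simp
  obtain Y where Y: "primitive_of Y (wderiv y)" "AE t in unit_lebesgue. Y t = y t"
    using weak_deriv_imp_primitive[OF L2_integrable[OF y] L2_integrable[OF wderiv_props(1)[OF assms]]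
        wderiv_props(2)[OF assms]] by blast
  note p = pt_value_props[OF primitive_of_continuous[OF Y(1)] Y(2)]
  show "AE t in unit_lebesgue. pt_value y t = y t" by (rule p(1))
  show "primitive_of (pt_value y) (wderiv y)"
    unfolding primitive_of_def
  proof (intro conjI ballI)
    show "integrable unit_lebesgue (wderiv y)" using Y(1) by (simp add: primitive_of_def)
    fix t :: real assume t: "t \<in> {0..1}"
    have "Y t = Y 0 + integral {0..t} (wderiv y)"
      using Y(1) t unfolding primitive_of_def by blast
    moreover have "pt_value y 0 = Y 0" by (rule p(2)) simp
    ultimately show "pt_value y t = pt_value y 0 + integral {0..t} (wderiv y)"
      using p(2)[OF t] by metis
  qed
qed

text \<open>The derivative that witnesses membership in \<open>H\<^sup>2\<close> may be replaced by \<^term>\<open>wderiv y\<close>, since both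
  agree almost everywhere.\<close>

lemma sobolev_2_iff: "y \<in> sobolev 2 \<longleftrightarrow> y \<in> sobolev 1 \<and> wderiv y \<in> sobolev 1"
proof
  assume "y \<in> sobolev 2"
  then obtain g where y: "y \<in> L2" and g: "g \<in> sobolev 1" "has_weak_deriv y g"
    by (auto simp: numeral_2_eq_2)
  then have gL: "g \<in> L2" by simp
  have y1: "y \<in> sobolev 1" using y gL g(2) by auto
  have "wderiv y \<in> L2" by (rule wderiv_props(1)[OF y1])
  moreover obtain h where "h \<in> L2" "has_weak_deriv g h" using g(1) by auto
  moreover have "has_weak_deriv (wderiv y) h \<longleftrightarrow> has_weak_deriv g h"
    by (rule has_weak_deriv_cong_AE[OF L2_measurable L2_measurable wderiv_AE_eq[OF y gL g(2)]])
       (use gL wderiv_props(1)[OF y1] in auto)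
  ultimately show "y \<in> sobolev 1 \<and> wderiv y \<in> sobolev 1" using y1 by auto
next
  assume a: "y \<in> sobolev 1 \<and> wderiv y \<in> sobolev 1"
  then show "y \<in> sobolev 2"
    using wderiv_props(2)[of y] by (auto simp: numeral_2_eq_2)
qed

lemma sobolev_integration_by_parts:
  assumes y: "y \<in> sobolev 1" and v: "v \<in> sobolev 1"
  shows "(LINT t|unit_lebesgue. y t * cnj (wderiv v t)) + (LINT t|unit_lebesgue. wderiv y t * cnj (v t))
       = pt_value y 1 * cnj (pt_value v 1) - pt_value y 0 * cnj (pt_value v 0)"
proof -
  note py = sobolev_1_primitive[OF y] and pv = sobolev_1_primitive[OF v]
  note pv' = primitive_of_cnj[OF pv(1)]
  have [measurable]: "y \<in> borel_measurable unit_lebesgue" "(\<lambda>t. cnj (v t)) \<in> borel_measurable unit_lebesgue"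
    "wderiv y \<in> borel_measurable unit_lebesgue" "(\<lambda>t. cnj (wderiv v t)) \<in> borel_measurable unit_lebesgue"
    "pt_value y \<in> borel_measurable unit_lebesgue" "(\<lambda>t. cnj (pt_value v t)) \<in> borel_measurable unit_lebesgue"
    using y v wderiv_props(1)
    by (auto intro: L2_measurable L2_cnj continuous_measurable_unit primitive_of_continuous py pv')
  have 1: "(LINT t|unit_lebesgue. y t * cnj (wderiv v t)) = (LINT t|unit_lebesgue. pt_value y t * cnj (wderiv v t))"
    by (rule integral_cong_AE) (measurable, use py(2) in eventually_elim, simp)
  have 2: "(LINT t|unit_lebesgue. wderiv y t * cnj (v t)) = (LINT t|unit_lebesgue. wderiv y t * cnj (pt_value v t))"
    by (rule integral_cong_AE) (measurable, use pv(2) in eventually_elim, simp)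
  show ?thesis unfolding 1 2
    by (rule integration_by_parts_primitive[OF py(1) pv'])
qed

section \<open>Test functions on a single edge\<close>

lemma test_function_cnj:
  assumes "test_function \<phi>"
  shows "test_function (\<lambda>t. cnj (\<phi> t))"
    and "vector_derivative (\<lambda>t. cnj (\<phi> t)) (at t) = cnj (vector_derivative \<phi> (at t))"
proof -
  obtain a b where ab: "0 < a" "b < 1" "\<And>t. t \<notin> {a..b} \<Longrightarrow> \<phi> t = 0" and c: "\<phi> C1_differentiable_on UNIV"
    using assms test_functionE by metis
  have d: "((\<lambda>t. cnj (\<phi> t)) has_vector_derivative cnj (vector_derivative \<phi> (at t))) (at t)" for t
    using c by (intro has_vector_derivative_cnj) (auto simp: C1_differentiable_on_eq vector_derivative_works[symmetric])
  then show "vector_derivative (\<lambda>t. cnj (\<phi> t)) (at t) = cnj (vector_derivative \<phi> (at t))"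
    by (rule vector_derivative_at)
  have "continuous_on UNIV (\<lambda>t. cnj (vector_derivative \<phi> (at t)))"
    using c by (intro continuous_intros) (simp add: C1_differentiable_on_eq)
  then have "(\<lambda>t. cnj (\<phi> t)) C1_differentiable_on UNIV"
    unfolding C1_differentiable_on_def using d
    by (intro exI[of _ "\<lambda>t. cnj (vector_derivative \<phi> (at t))"]) simp
  then show "test_function (\<lambda>t. cnj (\<phi> t))"
    unfolding test_function_def using ab by (metis complex_cnj_zero)
qed

lemma test_function_sobolev:
  assumes "test_function \<phi>"
  shows "\<phi> \<in> sobolev 1" "AE t in unit_lebesgue. wderiv \<phi> t = vector_derivative \<phi> (at t)"
    "pt_value \<phi> 0 = 0" "pt_value \<phi> 1 = 0"
proof -
  obtain a b where ab: "0 < a" "b < 1" "\<And>t. t \<notin> {a..b} \<Longrightarrow> \<phi> t = 0" and c: "\<phi> C1_differentiable_on UNIV"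
    using assms test_functionE by metis
  have L: "\<phi> \<in> L2" "(\<lambda>t. vector_derivative \<phi> (at t)) \<in> L2"
    by (intro continuous_in_L2 test_function_continuous assms)+
  have w: "has_weak_deriv \<phi> (\<lambda>t. vector_derivative \<phi> (at t))"
    by (rule primitive_of_imp_has_weak_deriv[OF C1_primitive_of[OF c]])
  show "\<phi> \<in> sobolev 1" using L w by auto
  show "AE t in unit_lebesgue. wderiv \<phi> t = vector_derivative \<phi> (at t)"
    by (rule wderiv_AE_eq[OF L w])
  have "pt_value \<phi> t = \<phi> t" if "t \<in> {0..1}" for t
    by (rule pt_value_props(2)[OF test_function_continuous(1)[OF assms] _ that]) simp
  then show "pt_value \<phi> 0 = 0" "pt_value \<phi> 1 = 0"
    using ab by simp_all
qed

lemma test_function_zero: "test_function (\<lambda>_. 0)"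
  unfolding test_function_def by (intro conjI exI[of _ "1/2"]) auto

text \<open>The conjugate of a test function on one edge, continued by zero to the others, vanishes at all
  edge ends, so it satisfies any conditions (I) whatever.  The conjugate is taken because the
  form is antilinear in its second argument.\<close>

lemma single_edge_test:
  fixes i K :: nat
  assumes \<phi>: "test_function \<phi>"
  defines "v \<equiv> (\<lambda>j. if j = i then (\<lambda>t. cnj (\<phi> t)) else (\<lambda>_. 0))"
  shows "v \<in> form_domain K bc"
    and "\<And>j. gval v j 0 = 0" "\<And>j. gval v j 1 = 0"
proof -
  have t: "test_function (v j)" for j
    using test_function_cnj(1)[OF \<phi>] test_function_zero by (simp add: v_def)
  show z: "gval v j 0 = 0" "gval v j 1 = 0" for j
    using test_function_sobolev(3,4)[OF t] by (simp_all add: gval_def)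
  show "v \<in> form_domain K bc"
    unfolding form_domain_def graph_sobolev_def satisfies_I_def
    using test_function_sobolev(1)[OF t] z by (simp del: sobolev.simps One_nat_def)
qed

section \<open>Weak and strong solutions\<close>

text \<open>Green's formula: for \<open>u\<close> in \<open>H\<^sup>2\<close> the defect of the weak equation is the boundary term of the
  co-normal condition plus the defect of the differential equation, tested with \<open>v\<close>.\<close>

lemma form_minus_inner:
  assumes q: "\<forall>i\<in>{1..K}. essentially_bounded (q i)"
    and u: "u \<in> graph_sobolev K 2" and v: "v \<in> graph_sobolev K 1"
  shows "form K q f u v - lam * graph_inner K (B_op p u) v =
    boundary_integral K (\<lambda>i t. (f i t * gval u i t + gval (gderiv u) i t) * cnj (gval v i t))
    + graph_integral K (\<lambda>i t. (l_op q u i t - lam * B_op p u i t) * cnj (v i t))"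
proof -
  have *: "(f i 1 * gval u i 1 * cnj (gval v i 1) - f i 0 * gval u i 0 * cnj (gval v i 0))
    + (LINT t|unit_lebesgue. gderiv u i t * cnj (gderiv v i t) + complex_of_real (q i t) * u i t * cnj (v i t))
    - lam * (LINT t|unit_lebesgue. B_op p u i t * cnj (v i t))
    = ((f i 1 * gval u i 1 + gval (gderiv u) i 1) * cnj (gval v i 1)
      - (f i 0 * gval u i 0 + gval (gderiv u) i 0) * cnj (gval v i 0))
    + (LINT t|unit_lebesgue. (l_op q u i t - lam * B_op p u i t) * cnj (v i t))" if i: "i \<in> {1..K}" for i
  proof -
    have u2: "u i \<in> sobolev 1" "wderiv (u i) \<in> sobolev 1"
      using u i by (auto simp: graph_sobolev_def sobolev_2_iff simp del: sobolev.simps One_nat_def)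
    have v1: "v i \<in> sobolev 1" using v i by (simp add: graph_sobolev_def)
    have uL: "u i \<in> L2" "wderiv (u i) \<in> L2" "wderiv (wderiv (u i)) \<in> L2"
      using u2 wderiv_props(1) by auto
    have vL: "(\<lambda>t. cnj (v i t)) \<in> L2" "(\<lambda>t. cnj (wderiv (v i) t)) \<in> L2"
      using v1 wderiv_props(1)[OF v1] by (auto intro: L2_cnj)
    have qL: "(\<lambda>t. complex_of_real (q i t) * u i t) \<in> L2"
      using q i uL(1) by (intro L2_bounded_mult) auto
    have i1: "integrable unit_lebesgue (\<lambda>t. wderiv (u i) t * cnj (wderiv (v i) t))"
      by (rule L2_product_integrable[OF uL(2) vL(2)])
    have i2: "integrable unit_lebesgue (\<lambda>t. complex_of_real (q i t) * u i t * cnj (v i t))"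
      by (rule L2_product_integrable[OF qL vL(1)])
    have i3: "integrable unit_lebesgue (\<lambda>t. u i t * cnj (v i t))"
      by (rule L2_product_integrable[OF uL(1) vL(1)])
    have i4: "integrable unit_lebesgue (\<lambda>t. wderiv (wderiv (u i)) t * cnj (v i t))"
      by (rule L2_product_integrable[OF uL(3) vL(1)])
    have B: "(LINT t|unit_lebesgue. B_op p u i t * cnj (v i t))
       = weight p i * (LINT t|unit_lebesgue. u i t * cnj (v i t))"
      by (simp add: B_op_def mult.assoc)
    have "(LINT t|unit_lebesgue. (l_op q u i t - lam * B_op p u i t) * cnj (v i t))
      = (LINT t|unit_lebesgue. complex_of_real (q i t) * u i t * cnj (v i t)
          - wderiv (wderiv (u i)) t * cnj (v i t) - (lam * weight p i) * (u i t * cnj (v i t)))"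
      by (rule Bochner_Integration.integral_cong) (simp_all add: l_op_def B_op_def gderiv_def algebra_simps)
    also have "\<dots> = (LINT t|unit_lebesgue. complex_of_real (q i t) * u i t * cnj (v i t))
          - (LINT t|unit_lebesgue. wderiv (wderiv (u i)) t * cnj (v i t))
          - (lam * weight p i) * (LINT t|unit_lebesgue. u i t * cnj (v i t))"
      using i2 i3 i4 by simp
    finally have l: "(LINT t|unit_lebesgue. (l_op q u i t - lam * B_op p u i t) * cnj (v i t)) = \<dots>" .
    have "(LINT t|unit_lebesgue. gderiv u i t * cnj (gderiv v i t) + complex_of_real (q i t) * u i t * cnj (v i t))
       = (LINT t|unit_lebesgue. wderiv (u i) t * cnj (wderiv (v i) t))
        + (LINT t|unit_lebesgue. complex_of_real (q i t) * u i t * cnj (v i t))"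
      using i1 i2 by (simp add: gderiv_def)
    then show ?thesis
      using sobolev_integration_by_parts[OF u2(2) v1] unfolding l B
      by (simp add: gval_def gderiv_def algebra_simps)
  qed
  show ?thesis
    unfolding form_def boundary_integral_def graph_integral_def graph_inner_def
      sum_distrib_left sum.distrib[symmetric] sum_subtractf[symmetric]
    by (rule sum.cong[OF refl]) (rule *)
qed

text \<open>Tested with functions supported on the \<open>i\<close>-th edge, the weak equation says that
  \<open>u'\<close> has the weak derivative that the differential equation prescribes for \<open>u''\<close>.\<close>

lemma weak_solution_weak_deriv:
  assumes q: "\<forall>i\<in>{1..K}. essentially_bounded (q i)"
    and u: "u \<in> form_domain K bc"
    and eq: "\<forall>v\<in>form_domain K bc. form K q f u v = lam * graph_inner K (B_op p u) v"
    and i: "i \<in> {1..K}"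
  shows "has_weak_deriv (wderiv (u i)) (\<lambda>t. complex_of_real (q i t) * u i t - lam * weight p i * u i t)"
  unfolding has_weak_deriv_def
proof safe
  fix \<phi> assume \<phi>: "test_function \<phi>"
  define v where "v = (\<lambda>j. if j = i then (\<lambda>t. cnj (\<phi> t)) else (\<lambda>_. 0))"
  note s = single_edge_test[OF \<phi>, of i, folded v_def]
  have vi: "v i = (\<lambda>t. cnj (\<phi> t))" and vj: "\<And>j. j \<noteq> i \<Longrightarrow> v j = (\<lambda>_. 0)" by (auto simp: v_def)
  have u1: "u j \<in> sobolev 1" if "j \<in> {1..K}" for j
    using u that by (auto simp: form_domain_def graph_sobolev_def)
  have uL: "u j \<in> L2" "wderiv (u j) \<in> L2" if "j \<in> {1..K}" for j
    using u1[OF that] wderiv_props(1)[OF u1[OF that]] by auto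
  have iu: "integrable unit_lebesgue (\<lambda>t. u i t * \<phi> t)"
    "integrable unit_lebesgue (\<lambda>t. complex_of_real (q i t) * u i t * \<phi> t)"
    "integrable unit_lebesgue (\<lambda>t. wderiv (u i) t * vector_derivative \<phi> (at t))"
    by (intro integrable_mult_test_function[OF \<phi>] L2_integrable uL i L2_bounded_mult bspec[OF q])+
  have 0: "(LINT t|unit_lebesgue. gderiv u j t * cnj (gderiv v j t) + complex_of_real (q j t) * u j t * cnj (v j t)) = 0"
    if "j \<in> {1..K}" "j \<noteq> i" for j
  proof -
    have "AE t in unit_lebesgue. wderiv (v j) t = 0"
      using test_function_sobolev(2)[OF test_function_zero] by (simp add: vj[OF that(2)])
    then have "AE t in unit_lebesgue. gderiv u j t * cnj (gderiv v j t) + complex_of_real (q j t) * u j t * cnj (v j t) = 0"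
      by eventually_elim (simp add: gderiv_def vj[OF that(2)])
    then show ?thesis by (rule integral_eq_zero_AE)
  qed
  have "form K q f u v = (\<Sum>j=1..K. LINT t|unit_lebesgue. gderiv u j t * cnj (gderiv v j t) + complex_of_real (q j t) * u j t * cnj (v j t))"
    using s(2,3) by (simp add: form_def boundary_integral_def graph_integral_def)
  also have "\<dots> = (LINT t|unit_lebesgue. gderiv u i t * cnj (gderiv v i t) + complex_of_real (q i t) * u i t * cnj (v i t))"
    using 0 i by (subst sum.remove[of _ i]) auto
  also have "\<dots> = (LINT t|unit_lebesgue. wderiv (u i) t * vector_derivative \<phi> (at t) + complex_of_real (q i t) * u i t * \<phi> t)"
  proof (rule integral_cong_AE)
    have d: "AE t in unit_lebesgue. wderiv (v i) t = cnj (vector_derivative \<phi> (at t))"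
      using test_function_sobolev(2)[OF test_function_cnj(1)[OF \<phi>]] test_function_cnj(2)[OF \<phi>]
      by (simp add: vi)
    show "AE t in unit_lebesgue. gderiv u i t * cnj (gderiv v i t) + complex_of_real (q i t) * u i t * cnj (v i t)
        = wderiv (u i) t * vector_derivative \<phi> (at t) + complex_of_real (q i t) * u i t * \<phi> t"
      using d by eventually_elim (simp add: gderiv_def vi)
    have "(\<lambda>t. cnj (gderiv v i t)) \<in> L2"
      unfolding gderiv_def vi
      by (intro L2_cnj wderiv_props(1) test_function_sobolev(1) test_function_cnj(1) \<phi>)
    then have "integrable unit_lebesgue (\<lambda>t. gderiv u i t * cnj (gderiv v i t))"
      using uL[OF i] by (intro L2_product_integrable) (simp_all add: gderiv_def)
    then have "integrable unit_lebesgue (\<lambda>t. gderiv u i t * cnj (gderiv v i t) + complex_of_real (q i t) * u i t * cnj (v i t))"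
      using iu(2) by (simp add: vi)
    then show "(\<lambda>t. gderiv u i t * cnj (gderiv v i t) + complex_of_real (q i t) * u i t * cnj (v i t)) \<in> borel_measurable unit_lebesgue"
      by (rule borel_measurable_integrable)
    show "(\<lambda>t. wderiv (u i) t * vector_derivative \<phi> (at t) + complex_of_real (q i t) * u i t * \<phi> t) \<in> borel_measurable unit_lebesgue"
      using iu by (intro borel_measurable_integrable) simp
  qed
  also have "\<dots> = (LINT t|unit_lebesgue. wderiv (u i) t * vector_derivative \<phi> (at t))
      + (LINT t|unit_lebesgue. complex_of_real (q i t) * u i t * \<phi> t)"
    using iu by simp
  finally have F: "form K q f u v = \<dots>" .
  have "graph_inner K (B_op p u) v = (LINT t|unit_lebesgue. B_op p u i t * cnj (v i t))"
    unfolding graph_inner_def graph_integral_def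
    using i by (subst sum.remove[of _ i]) (auto simp: vj)
  also have "\<dots> = weight p i * (LINT t|unit_lebesgue. u i t * \<phi> t)"
    by (simp add: B_op_def vi mult.assoc)
  finally have G: "graph_inner K (B_op p u) v = \<dots>" .
  have "(LINT t|unit_lebesgue. (complex_of_real (q i t) * u i t - lam * weight p i * u i t) * \<phi> t)
    = (LINT t|unit_lebesgue. complex_of_real (q i t) * u i t * \<phi> t - lam * weight p i * (u i t * \<phi> t))"
    by (simp add: algebra_simps)
  also have "\<dots> = (LINT t|unit_lebesgue. complex_of_real (q i t) * u i t * \<phi> t)
      - lam * weight p i * (LINT t|unit_lebesgue. u i t * \<phi> t)"
    using iu by simp
  finally have R: "(LINT t|unit_lebesgue. (complex_of_real (q i t) * u i t - lam * weight p i * u i t) * \<phi> t) = \<dots>" .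
  have "form K q f u v = lam * graph_inner K (B_op p u) v"
    using eq s(1) by blast
  then have "(LINT t|unit_lebesgue. wderiv (u i) t * vector_derivative \<phi> (at t))
      + (LINT t|unit_lebesgue. complex_of_real (q i t) * u i t * \<phi> t)
      = lam * weight p i * (LINT t|unit_lebesgue. u i t * \<phi> t)"
    unfolding F G by (simp only: mult.assoc)
  then show "(LINT t|unit_lebesgue. wderiv (u i) t * vector_derivative \<phi> (at t)) =
    - (LINT t|unit_lebesgue. (complex_of_real (q i t) * u i t - lam * weight p i * u i t) * \<phi> t)"
    unfolding R by (simp only: minus_diff_eq eq_diff_eq)
qed

text \<open>Interior regularity: the prescribed second derivative lies in \<open>L\<^sup>2\<close>, because \<open>q\<close> is essentially
  bounded.\<close>

lemma weak_solution_regular: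
  assumes q: "\<forall>i\<in>{1..K}. essentially_bounded (q i)"
    and u: "u \<in> form_domain K bc"
    and eq: "\<forall>v\<in>form_domain K bc. form K q f u v = lam * graph_inner K (B_op p u) v"
  shows "u \<in> graph_sobolev K 2"
    and "\<forall>i\<in>{1..K}. AE t in unit_lebesgue. l_op q u i t = lam * B_op p u i t"
proof -
  have *: "u i \<in> sobolev 2 \<and> (AE t in unit_lebesgue. l_op q u i t = lam * B_op p u i t)" if i: "i \<in> {1..K}" for i
  proof -
    define g where "g t = complex_of_real (q i t) * u i t - lam * weight p i * u i t" for t
    have u1: "u i \<in> sobolev 1" using u i by (auto simp: form_domain_def graph_sobolev_def)
    then have uL: "u i \<in> L2" "wderiv (u i) \<in> L2" using wderiv_props(1) by auto
    have gL: "g \<in> L2" unfolding g_def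
      using q i uL(1) by (intro L2_diff L2_bounded_mult L2_cmult) auto
    have w: "has_weak_deriv (wderiv (u i)) g"
      using weak_solution_weak_deriv[OF q u eq i] unfolding g_def[abs_def] .
    have "wderiv (u i) \<in> sobolev 1" using uL(2) gL w by auto
    moreover have "AE t in unit_lebesgue. wderiv (wderiv (u i)) t = g t"
      by (rule wderiv_AE_eq[OF uL(2) gL w])
    then have "AE t in unit_lebesgue. l_op q u i t = lam * B_op p u i t"
      by eventually_elim (simp add: l_op_def B_op_def gderiv_def g_def)
    ultimately show ?thesis using u1 by (simp add: sobolev_2_iff del: sobolev.simps One_nat_def)
  qed
  then show "u \<in> graph_sobolev K 2"
    "\<forall>i\<in>{1..K}. AE t in unit_lebesgue. l_op q u i t = lam * B_op p u i t"
    by (auto simp: graph_sobolev_def)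
qed

theorem lemma3p2:
  fixes G :: "('v, nat) pre_digraph"
    and K p :: nat
    and q :: "nat \<Rightarrow> real \<Rightarrow> real"
    and bc :: bdry_conds
    and f u :: graph_fun
    and lam :: complex
  assumes "wf_digraph G" and "arcs G = {1..K}" and "p \<le> K"
    and "\<forall>i\<in>{1..K}. essentially_bounded (q i)"
    and "padded K bc" and "local_conds G K bc" and "independent_conds K bc"
    and "dirichlet_like_in_I K bc"
    and "formally_self_adjoint K q bc"
    and "co_normal_via K bc f"
  shows "(u \<in> form_domain K bc \<and>
          (\<forall>v\<in>form_domain K bc. form K q f u v = lam * graph_inner K (B_op p u) v))
     \<longleftrightarrow> (u \<in> graph_sobolev K 2 \<and>
          (\<forall>i\<in>{1..K}. AE t in unit_lebesgue. l_op q u i t = lam * B_op p u i t) \<and>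
          satisfies_I K bc u \<and> satisfies_II K bc u)"
proof -
  note q = assms(4) and co = assms(10)
  let ?bd = "\<lambda>v. boundary_integral K (\<lambda>i t. (f i t * gval u i t + gval (gderiv u) i t) * cnj (gval v i t))"
  have key: "form K q f u v - lam * graph_inner K (B_op p u) v = ?bd v"
    if u2: "u \<in> graph_sobolev K 2" and v: "v \<in> form_domain K bc"
      and ode: "\<forall>i\<in>{1..K}. AE t in unit_lebesgue. l_op q u i t = lam * B_op p u i t" for v
  proof -
    have "(LINT t|unit_lebesgue. (l_op q u i t - lam * B_op p u i t) * cnj (v i t)) = 0" if "i \<in> {1..K}" for i
      by (rule integral_eq_zero_AE) (use ode that in \<open>auto elim!: eventually_mono\<close>)
    then have "graph_integral K (\<lambda>i t. (l_op q u i t - lam * B_op p u i t) * cnj (v i t)) = 0"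
      by (simp add: graph_integral_def)
    then show ?thesis
      using form_minus_inner[OF q u2, of v f lam p] v by (simp add: form_domain_def)
  qed
  show ?thesis
  proof (intro iffI conjI; elim conjE)
    assume u: "u \<in> form_domain K bc"
      and eq: "\<forall>v\<in>form_domain K bc. form K q f u v = lam * graph_inner K (B_op p u) v"
    note reg = weak_solution_regular[OF q u eq]
    show "u \<in> graph_sobolev K 2"
      and "\<forall>i\<in>{1..K}. AE t in unit_lebesgue. l_op q u i t = lam * B_op p u i t" by (fact reg)+
    show "satisfies_I K bc u" using u by (simp add: form_domain_def)
    have "\<forall>v\<in>form_domain K bc. ?bd v = 0" using key reg eq by force
    then show "satisfies_II K bc u" using co u reg(1) by (auto simp: co_normal_via_def)
  next
    assume u: "u \<in> graph_sobolev K 2"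
      and ode: "\<forall>i\<in>{1..K}. AE t in unit_lebesgue. l_op q u i t = lam * B_op p u i t"
      and bc: "satisfies_I K bc u" "satisfies_II K bc u"
    have "u \<in> graph_sobolev K 1"
      using u unfolding graph_sobolev_def sobolev_2_iff by blast
    then show ud: "u \<in> form_domain K bc" using bc by (simp add: form_domain_def)
    have "\<forall>v\<in>form_domain K bc. ?bd v = 0"
      using co ud u bc(2) by (auto simp: co_normal_via_def)
    then show "\<forall>v\<in>form_domain K bc. form K q f u v = lam * graph_inner K (B_op p u) v"
      using key[OF u _ ode] by simp
  qed
qed

end
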